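(* Let $\{(N_n,B_n)\}_{n=1}^\infty$ be a sequence of admissible pairs in $\mathbb{R}$ with $N_n>0$, satisfying the remainder bounded condition $$\sum_{n=1}^{\infty}\frac{\#B_{n,2}}{\#B_n}<\infty,$$ where $B_{n,1}=B_n\cap\{0,1,\dots,N_n-1\}$ and $B_{n,2}=B_n\setminus B_{n,1}$. Suppose there exists a subsequence $\{B_{n_k}\}_{k=1}^\infty$ such that each $B_{n_k}$ is a general consecutive set with respect to $N_{n_k}$. Then the infinite convolution $$\mu=\delta_{N_1^{-1}B_1}*\delta_{(N_2N_1)^{-1}B_2}*\cdots*\delta_{(N_n\cdots N_2N_1)^{-1}B_n}*\cdots$$ exists and is a spectral measure.
   Context: An admissible pair in $\mathbb{R}$ is a pair $(N,B)$ where $N$ is an integer with $|N|>1$ and $B\subseteq\mathbb{Z}$ is finite with $\#B\ge2$, such that there exists $L\subseteq\mathbb{Z}$ with $\#L=\#B$ for which the matrix $\big[\frac{1}{\sqrt{\#B}}e^{-2\pi i (b/N)\ell}\big]_{b\in B,\ell\in L}$ is unitary. For an admissible pair $(N,B)$, $B$ is a general consecutive set if $B\equiv\{0,1,\dots,\#B-1\}\pmod N$, i.e. the set of residues modulo $N$ of the elements of $B$ is $\{0,1,\dots,\#B-1\}$. For finite $A\subseteq\mathbb{R}$, $\delta_A=\frac{1}{\#A}\sum_{a\in A}\delta_a$; $*$ is convolution. The infinite convolution is the weak limit (if it exists) of $\mu_n=\delta_{N_1^{-1}B_1}*\cdots*\delta_{(N_n\cdots N_1)^{-1}B_n}$. A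 Borel probability measure $\mu$ on $\mathbb{R}$ is spectral if there is a countable $\Lambda\subseteq\mathbb{R}$ such that $\{e^{-2\pi i\lambda x}:\lambda\in\Lambda\}$ is an orthonormal basis of $L^2(\mu)$. *)

theory Defs
  imports "HOL-Probability.Probability"
begin

definition adm_entry :: "int \<Rightarrow> int set \<Rightarrow> int \<Rightarrow> int \<Rightarrow> complex" where
  "adm_entry N B b l =
     complex_of_real (1 / sqrt (real (card B))) *
     cis (- 2 * pi * (real_of_int b / real_of_int N) * real_of_int l)"

definition adm_unitary :: "int \<Rightarrow> int set \<Rightarrow> int set \<Rightarrow> bool" where
  "adm_unitary N B L \<longleftrightarrow>
     (\<forall>b\<in>B. \<forall>b'\<in>B. (\<Sum>l\<in>L. adm_entry N B b l * cnj (adm_entry N B b' l))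
                      = (if b = b' then 1 else 0)) \<and>
     (\<forall>l\<in>L. \<forall>l'\<in>L. (\<Sum>b\<in>B. cnj (adm_entry N B b l) * adm_entry N B b l')
                      = (if l = l' then 1 else 0))"

definition admissible_pair :: "int \<Rightarrow> int set \<Rightarrow> bool" where
  "admissible_pair N B \<longleftrightarrow>
     \<bar>N\<bar> > 1 \<and> finite B \<and> card B \<ge> 2 \<and>
     (\<exists>L :: int set. finite L \<and> card L = card B \<and> adm_unitary N B L)"

definition general_consecutive :: "int \<Rightarrow> int set \<Rightarrow> bool" where
  "general_consecutive N B \<longleftrightarrow> (\<lambda>b. b mod N) ` B = {0..<int (card B)}"

definition delta_set :: "real set \<Rightarrow> real measure" where
  "delta_set A = distr (measure_pmf (pmf_of_set A)) borel (\<lambda>x. x)"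

text \<open>Partial products N_n ... N_1 (sequences indexed from 0: index j is the paper's j+1).\<close>
definition partial_prod :: "(nat \<Rightarrow> int) \<Rightarrow> nat \<Rightarrow> int" where
  "partial_prod N n = (\<Prod>j\<in>{0..n}. N j)"

fun conv_partial :: "(nat \<Rightarrow> int) \<Rightarrow> (nat \<Rightarrow> int set) \<Rightarrow> nat \<Rightarrow> real measure" where
  "conv_partial N B 0 =
     delta_set ((\<lambda>b. real_of_int b / real_of_int (partial_prod N 0)) ` B 0)"
| "conv_partial N B (Suc n) =
     convolution (conv_partial N B n)
     (delta_set ((\<lambda>b. real_of_int b / real_of_int (partial_prod N (Suc n))) ` B (Suc n)))"

definition weak_converges :: "(nat \<Rightarrow> real measure) \<Rightarrow> real measure \<Rightarrow> bool" where
  "weak_converges \<mu>s \<mu> \<longleftrightarrow>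
     (\<forall>f :: real \<Rightarrow> real. continuous_on UNIV f \<longrightarrow> bounded (range f) \<longrightarrow>
        (\<lambda>n. integral\<^sup>L (\<mu>s n) f) \<longlonglongrightarrow> integral\<^sup>L \<mu> f)"

definition expfun :: "real \<Rightarrow> real \<Rightarrow> complex" where
  "expfun t x = cis (- 2 * pi * t * x)"

definition square_integrable :: "real measure \<Rightarrow> (real \<Rightarrow> complex) \<Rightarrow> bool" where
  "square_integrable \<mu> f \<longleftrightarrow>
     f \<in> borel_measurable \<mu> \<and> integrable \<mu> (\<lambda>x. (cmod (f x))\<^sup>2)"

text \<open>{e_lambda : lambda in Lambda} is an orthonormal basis of L^2(mu):
  orthonormal, and complete (only the zero class is orthogonal to all of them).\<close>
definition spectral_measure :: "real measure \<Rightarrow> bool" where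
  "spectral_measure \<mu> \<longleftrightarrow>
     (\<exists>\<Lambda> :: real set. countable \<Lambda> \<and>
        (\<forall>t\<in>\<Lambda>. \<forall>s\<in>\<Lambda>.
           integral\<^sup>L \<mu> (\<lambda>x. expfun t x * cnj (expfun s x)) = (if t = s then 1 else 0)) \<and>
        (\<forall>f. square_integrable \<mu> f \<longrightarrow>
           (\<forall>t\<in>\<Lambda>. integral\<^sup>L \<mu> (\<lambda>x. f x * cnj (expfun t x)) = 0) \<longrightarrow>
           (AE x in \<mu>. f x = 0)))"

end

theory Submission
  imports Defs
begin

text \<open>
  Writing \<open>Q n = N 0 * ... * N (n - 1)\<close>, the Fourier transform of the \<open>n\<close>-th partial convolution is a
  product \<open>phi n\<close> of mask functions, periodic modulo \<open>Q n\<close>. Adding the digits of the dual sets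
  \<open>L n\<close> one level at a time and always reducing to the centred residue modulo \<open>Q n\<close> yields an
  increasing family of spectra of the partial convolutions, contained in \<open>[- Q n / 2, Q n / 2]\<close>.
  The union is orthonormal for the limit measure. It satisfies Parseval's identity for every
  exponential as soon as no mass escapes, i.e. as soon as the transform of the rescaled tail is
  bounded away from 0 on a neighbourhood of \<open>[- 1/2, 1/2]\<close> for infinitely many \<open>n\<close>. This holds at the
  general consecutive levels: the mask of the first tail digit is close to a Dirichlet kernel
  inside its main lobe, and the remaining tail is nearly supported on \<open>[0, 1]\<close> while its frequency
  is at most \<open>1/3\<close>.
\<close>

subsection \<open>Mask functions\<close>

text \<open>Fourier transform at frequency \<open>u\<close> of the uniform probability measure on
  \<open>B\<close>.\<close>

definition mask_fun :: "int set \<Rightarrow> real \<Rightarrow> complex" where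
  "mask_fun B u = (\<Sum>b\<in>B. cis (- 2 * pi * u * of_int b)) / of_nat (card B)"

lemma norm_mask_fun_le_1: "norm (mask_fun B u) \<le> 1"
proof -
  have "norm (\<Sum>b\<in>B. cis (- 2 * pi * u * of_int b)) \<le> (\<Sum>b\<in>B. 1)"
    by (rule sum_norm_le) simp
  then show ?thesis
    by (cases "card B = 0") (auto simp: mask_fun_def norm_divide divide_le_eq)
qed

lemma mask_fun_0: "finite B \<Longrightarrow> B \<noteq> {} \<Longrightarrow> mask_fun B 0 = 1"
  by (simp add: mask_fun_def)

lemma mask_fun_add_int: "mask_fun B (u + of_int k) = mask_fun B u"
proof -
  have "cis (- 2 * pi * (u + of_int k) * of_int b) = cis (- 2 * pi * u * of_int b)" for b
  proof -
    have "- 2 * pi * (u + of_int k) * of_int b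
        = - 2 * pi * u * of_int b + 2 * pi * of_int (- k * b)"
      by (simp add: algebra_simps)
    also have "cis \<dots> = cis (- 2 * pi * u * of_int b)"
      by (subst cis_mult [symmetric], subst cis_multiple_2pi) auto
    finally show ?thesis .
  qed
  then show ?thesis by (simp add: mask_fun_def)
qed

text \<open>Row orthogonality of the unitary matrix survives the shift by \<open>x\<close>, which
  only multiplies row \<open>b\<close> by a unimodular factor. Expanding the squared moduli and
  summing over \<open>L\<close> first leaves the diagonal \<open>b = b'\<close>. Since the identity
  holds for every \<open>x\<close>, \<open>L\<close> may be translated so that it contains
  0.\<close>

lemma admissible_pair_spectrum:
  assumes "admissible_pair N B"
  obtains L where "finite L" "0 \<in> L"
    "\<And>x. (\<Sum>l\<in>L. (norm (mask_fun B (x + of_int l / of_int N)))\<^sup>2) = 1"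
proof -
  define m where "m = card B"
  from assms obtain L where L: "finite L" "card L = m" and U: "adm_unitary N B L"
    and B: "finite B" "m \<ge> 2" by (auto simp: admissible_pair_def m_def)
  have m0: "m > 0" using B by simp
  define e where "e l b x = cis (- 2 * pi * (x + of_int l / of_int N) * of_int b)" for l b :: int and x :: real
  have U': "(\<Sum>l\<in>L. e l b x * cnj (e l b' x)) = (if b = b' then of_nat m else 0)"
    if b: "b \<in> B" "b' \<in> B" for b b' x
  proof -
    have e_eq: "e l b x * cnj (e l b' x)
      = cis (- 2 * pi * x * of_int (b - b')) * of_nat m * (adm_entry N B b l * cnj (adm_entry N B b' l))"
      for l
    proof -
      have "e l b x * cnj (e l b' x) = cis (- 2 * pi * x * of_int (b - b'))
        * (cis (- 2 * pi * (of_int b / of_int N) * of_int l) * cnj (cis (- 2 * pi * (of_int b' / of_int N) * of_int l)))"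
        by (simp add: e_def cis_cnj cis_mult algebra_simps)
      moreover have "adm_entry N B b l * cnj (adm_entry N B b' l) =
         (cis (- 2 * pi * (of_int b / of_int N) * of_int l) * cnj (cis (- 2 * pi * (of_int b' / of_int N) * of_int l))) / of_nat m"
      proof -
        have arr: "(c * a) * (c * b) = a * b / M" if "c * c = 1 / M" for a b c M :: complex
        proof -
          have "(c * a) * (c * b) = (c * c) * (a * b)" by (simp only: mult_ac)
          then show ?thesis by (simp add: that)
        qed
        have "complex_of_real (1 / sqrt (real m)) * complex_of_real (1 / sqrt (real m)) = 1 / of_nat m"
          by (simp flip: of_real_mult)
        then show ?thesis
          unfolding adm_entry_def m_def[symmetric] complex_cnj_mult complex_cnj_complex_of_real
          using arr by metis
      qed
      ultimately show ?thesis using m0 by simp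
    qed
    have "(\<Sum>l\<in>L. e l b x * cnj (e l b' x)) =
      cis (- 2 * pi * x * of_int (b - b')) * of_nat m * (\<Sum>l\<in>L. adm_entry N B b l * cnj (adm_entry N B b' l))"
      by (simp only: e_eq sum_distrib_left)
    also have "(\<Sum>l\<in>L. adm_entry N B b l * cnj (adm_entry N B b' l)) = (if b = b' then 1 else 0)"
      using U b by (auto simp: adm_unitary_def)
    finally show ?thesis by auto
  qed
  have main: "(\<Sum>l\<in>L. (norm (mask_fun B (x + of_int l / of_int N)))\<^sup>2) = 1" for x
  proof -
    have "complex_of_real (\<Sum>l\<in>L. (norm (mask_fun B (x + of_int l / of_int N)))\<^sup>2)
        = (\<Sum>l\<in>L. mask_fun B (x + of_int l / of_int N) * cnj (mask_fun B (x + of_int l / of_int N)))"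
      by (simp only: of_real_sum complex_norm_square)
    also have "\<dots> = (\<Sum>l\<in>L. (\<Sum>b\<in>B. \<Sum>b'\<in>B. e l b x * cnj (e l b' x))) / (of_nat m)\<^sup>2"
      unfolding mask_fun_def e_def[symmetric] m_def[symmetric]
      by (simp add: sum_product power2_eq_square sum_divide_distrib)
    also have "(\<Sum>l\<in>L. (\<Sum>b\<in>B. \<Sum>b'\<in>B. e l b x * cnj (e l b' x)))
        = (\<Sum>b\<in>B. \<Sum>b'\<in>B. \<Sum>l\<in>L. e l b x * cnj (e l b' x))"
      by (subst sum.swap, rule sum.cong [OF refl], rule sum.swap)
    also have "\<dots> = (\<Sum>b\<in>B. \<Sum>b'\<in>B. (if b = b' then of_nat m else 0))"
      by (intro sum.cong refl U')
    also have "\<dots> = (of_nat m)\<^sup>2"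
      using B by (simp add: m_def power2_eq_square)
    finally have "complex_of_real (\<Sum>l\<in>L. (norm (mask_fun B (x + of_int l / of_int N)))\<^sup>2) = 1"
      using m0 by simp
    then show ?thesis by (simp only: of_real_eq_1_iff)
  qed
  from L B have "L \<noteq> {}" by auto
  then obtain l0 where l0: "l0 \<in> L" by auto
  show thesis
  proof (rule that)
    show "finite ((\<lambda>l. l - l0) ` L)" using L by simp
    show "0 \<in> (\<lambda>l. l - l0) ` L" using l0 by (intro image_eqI[of _ _ l0]) auto
    fix x :: real
    have "(\<Sum>l\<in>(\<lambda>l. l - l0) ` L. (norm (mask_fun B (x + of_int l / of_int N)))\<^sup>2)
      = (\<Sum>l\<in>L. (norm (mask_fun B ((x - of_int l0 / of_int N) + of_int l / of_int N)))\<^sup>2)"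
      by (subst sum.reindex) (auto simp: inj_on_def diff_divide_distrib algebra_simps)
    then show "(\<Sum>l\<in>(\<lambda>l. l - l0) ` L. (norm (mask_fun B (x + of_int l / of_int N)))\<^sup>2) = 1"
      using main by simp
  qed
qed

section \<open>Perturbation of masks, and lower bounds for masks of consecutive sets\<close>

lemma norm_mask_fun_diff_le:
  assumes "finite B" "\<And>b. b \<in> B - E \<Longrightarrow> g b = b"
  shows "norm (mask_fun B u - (\<Sum>b\<in>B. cis (- 2 * pi * u * of_int (g b))) / of_nat (card B))
      \<le> 2 * real (card (B \<inter> E)) / real (card B)"
proof -
  have "(\<Sum>b\<in>B. cis (- 2 * pi * u * of_int b)) - (\<Sum>b\<in>B. cis (- 2 * pi * u * of_int (g b)))
      = (\<Sum>b\<in>B. cis (- 2 * pi * u * of_int b) - cis (- 2 * pi * u * of_int (g b)))"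
    by (simp add: sum_subtractf)
  also have "\<dots> = (\<Sum>b\<in>B \<inter> E. cis (- 2 * pi * u * of_int b) - cis (- 2 * pi * u * of_int (g b)))"
    using assms by (intro sum.mono_neutral_right) auto
  also have "norm \<dots> \<le> (\<Sum>b\<in>B \<inter> E. 2)"
    by (rule sum_norm_le) (rule norm_triangle_le_diff, simp)
  finally show ?thesis
    by (simp add: mask_fun_def norm_divide divide_right_mono flip: diff_divide_distrib)
qed

lemma sum_squares_centered:
  "(\<Sum>j<m. (real m - 1 - 2 * real j)\<^sup>2) = real m * ((real m)\<^sup>2 - 1) / 3"
proof -
  \<comment> \<open>The centre \<open>c\<close> is decoupled from the length \<open>k\<close> so
    that induction on \<open>k\<close> goes through; the claim is the case \<open>k = m\<close>,
    \<open>c = m - 1\<close>.\<close>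
  have *: "(\<Sum>j<k. (c - 2 * real j)\<^sup>2)
     = real k * c\<^sup>2 - 2 * c * real k * (real k - 1) + 2 * real k * (real k - 1) * (2 * real k - 1) / 3" for k c
    by (induction k) (auto simp: field_simps power2_eq_square)
  show ?thesis
    by (subst *) (simp add: field_simps power2_eq_square)
qed

lemma cos_ge_quadratic: "cos x \<ge> 1 - x\<^sup>2 / (2::real)"
proof -
  have "cos x = 1 - 2 * (sin (x / 2))\<^sup>2"
    using cos_double_sin[of "x/2"] by simp
  moreover have "(sin (x / 2))\<^sup>2 \<le> (x / 2)\<^sup>2"
    using abs_sin_x_le_abs_x[of "x/2"] unfolding abs_le_square_iff .
  ultimately show ?thesis by (simp add: power2_eq_square)
qed

lemma pi_squared_less_10: "pi\<^sup>2 < 10"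
proof -
  have "pi < 3.15" using pi_approx by simp
  then have "pi * pi < 3.15 * 3.15" by (intro mult_strict_mono) auto
  then show ?thesis by (simp add: power2_eq_square)
qed

text \<open>Multiplying by a phase makes the frequencies symmetric about 0, so the real part is a
  sum of cosines, each bounded below by its quadratic Taylor polynomial. With
  \<open>pi\<^sup>2 < 10\<close> the relative loss is at most \<open>(9 / 2) / 6 = 3 / 4\<close>,
  which leaves 1/4.\<close>

lemma norm_mask_fun_interval_ge:
  assumes "m > 0" "real m * \<bar>u\<bar> \<le> 2 / 3"
  shows "norm (mask_fun {0..<int m} u) \<ge> 1 / 4"
proof -
  define z where "z = (\<Sum>b\<in>{0..<int m}. cis (- 2 * pi * u * of_int b))"
  have z: "z = (\<Sum>j<m. cis (- 2 * pi * u * real j))"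
  proof -
    have "{0..<int m} = int ` {..<m}" using image_int_atLeastLessThan[of 0 m] by (simp add: lessThan_atLeast0)
    then show ?thesis unfolding z_def by (simp add: sum.reindex)
  qed
  have "real m - (pi * u)\<^sup>2 / 2 * (real m * ((real m)\<^sup>2 - 1) / 3)
      = (\<Sum>j<m. 1 - (pi * u * (real m - 1 - 2 * real j))\<^sup>2 / 2)"
    unfolding sum_squares_centered[symmetric]
    by (simp add: sum_subtractf sum_distrib_left power_mult_distrib mult_ac)
  also have "\<dots> \<le> (\<Sum>j<m. cos (pi * u * (real m - 1 - 2 * real j)))"
    by (intro sum_mono cos_ge_quadratic)
  also have "\<dots> = Re (cis (pi * u * (real m - 1)) * z)"
    unfolding z sum_distrib_left cis_mult Re_sum by (simp add: algebra_simps)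
  also have "\<dots> \<le> norm (cis (pi * u * (real m - 1)) * z)" by (rule complex_Re_le_cmod)
  also have "\<dots> = norm z" by (simp add: norm_mult)
  finally have 1: "real m - (pi * u)\<^sup>2 / 2 * (real m * ((real m)\<^sup>2 - 1) / 3) \<le> norm z" .
  have "(real m * \<bar>u\<bar>)\<^sup>2 \<le> (2 / 3)\<^sup>2" using assms by (intro power_mono) auto
  then have "(pi\<^sup>2) * (real m * \<bar>u\<bar>)\<^sup>2 \<le> 10 * (2/3)\<^sup>2"
    using pi_squared_less_10 by (intro mult_mono) auto
  moreover have "(pi * u)\<^sup>2 * ((real m)\<^sup>2 - 1) \<le> (pi\<^sup>2) * (real m * \<bar>u\<bar>)\<^sup>2"
    by (simp add: algebra_simps power_mult_distrib)
  moreover have "10 * (2 / 3)\<^sup>2 \<le> (9 / 2 :: real)" by (simp add: power2_eq_square)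
  ultimately have "(pi * u)\<^sup>2 * ((real m)\<^sup>2 - 1) \<le> 9 / 2" by linarith
  then have "real m * ((pi * u)\<^sup>2 * ((real m)\<^sup>2 - 1)) \<le> real m * (9 / 2)" by (intro mult_left_mono) auto
  moreover have "(pi * u)\<^sup>2 / 2 * (real m * ((real m)\<^sup>2 - 1) / 3)
      = real m * ((pi * u)\<^sup>2 * ((real m)\<^sup>2 - 1)) / 6"
    by simp
  ultimately have "real m / 4 \<le> norm z" using 1 by linarith
  then show ?thesis
    unfolding mask_fun_def z_def[symmetric] using assms(1) by (simp add: norm_divide le_divide_eq)
qed

text \<open>Residues modulo \<open>N\<close> never reach \<open>N\<close> itself.\<close>

lemma general_consecutive_card_le:
  assumes "general_consecutive N B" "N > 0"
  shows "int (card B) \<le> N"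
proof (rule ccontr)
  assume "\<not> ?thesis"
  then have "N \<in> (\<lambda>b. b mod N) ` B" using assms by (auto simp: general_consecutive_def)
  then show False using assms(2) by (metis imageE order_less_irrefl pos_mod_bound)
qed

text \<open>A digit in \<open>{0..N - 1}\<close> is its own residue and hence lies in
  \<open>{0..<int (card B)}\<close>. So \<open>B\<close> and this interval share \<open>B1\<close>,
  each has \<open>r\<close> further elements, and their masks differ by at most
  \<open>2 * r / card B\<close>. The interval mask is at least 1/4 because
  \<open>card B <= N\<close>.\<close>

lemma norm_mask_fun_consecutive_ge:
  assumes "general_consecutive N B" "N > 0" "finite B" "B \<noteq> {}" "of_int N * \<bar>u\<bar> \<le> 2 / 3"
  shows "norm (mask_fun B u) \<ge> 1 / 4 - 2 * (real (card (B - B \<inter> {0..N - 1})) / real (card B))"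
proof -
  define m where "m = card B"
  define B1 where "B1 = B \<inter> {0..N - 1}"
  define r where "r = card (B - B1)"
  have m0: "m > 0" using assms by (auto simp: m_def card_gt_0_iff)
  let ?e = "\<lambda>b. cis (- 2 * pi * u * of_int b)"
  have sub: "B1 \<subseteq> {0..<int m}"
  proof
    fix b assume b: "b \<in> B1"
    then have "b mod N \<in> {0..<int m}"
      using assms(1) unfolding general_consecutive_def B1_def m_def by blast
    then show "b \<in> {0..<int m}" using b by (simp add: B1_def)
  qed
  have cB1: "card B1 = m - r" "r \<le> m"
    using assms card_mono[of B "B - B1"] by (auto simp: r_def m_def B1_def card_Diff_subset card_mono)
  have "(\<Sum>b\<in>B. ?e b) - (\<Sum>b\<in>{0..<int m}. ?e b) = (\<Sum>b\<in>B - B1. ?e b) - (\<Sum>b\<in>{0..<int m} - B1. ?e b)"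
    using assms(3) sub by (subst (1 2) sum_diff) (auto simp: B1_def)
  also have "norm \<dots> \<le> norm (\<Sum>b\<in>B - B1. ?e b) + norm (\<Sum>b\<in>{0..<int m} - B1. ?e b)"
    by (rule norm_triangle_ineq4)
  also have "\<dots> \<le> (\<Sum>b\<in>B - B1. 1) + (\<Sum>b\<in>{0..<int m} - B1. 1)"
    by (intro add_mono sum_norm_le) auto
  also have "\<dots> = 2 * real r"
    using sub cB1 by (simp add: r_def[symmetric] card_Diff_subset finite_subset of_nat_diff)
  finally have "norm (mask_fun B u - mask_fun {0..<int m} u) \<le> 2 * real r / real m"
    by (simp add: mask_fun_def m_def[symmetric] norm_divide divide_right_mono flip: diff_divide_distrib)
  moreover have "norm (mask_fun {0..<int m} u) \<ge> 1 / 4"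
  proof (rule norm_mask_fun_interval_ge [OF m0])
    have "real_of_int (int m) \<le> of_int N"
      using general_consecutive_card_le[OF assms(1,2)] unfolding m_def of_int_le_iff .
    then have "real m * \<bar>u\<bar> \<le> of_int N * \<bar>u\<bar>"
      by (intro mult_right_mono) auto
    with assms(5) show "real m * \<bar>u\<bar> \<le> 2 / 3" by linarith
  qed
  ultimately show ?thesis
    using norm_triangle_ineq2[of "mask_fun {0..<int m} u" "mask_fun B u"]
    by (simp add: r_def m_def B1_def norm_minus_commute)
qed

subsection \<open>Spectra of the partial convolutions\<close>

text \<open>Representative modulo \<open>P\<close> in a window centred at 0. Centring keeps the
  elements of the \<open>n\<close>-th spectrum within half of \<open>Q n\<close>, inside the range
  where the tail can be bounded below.\<close>

definition centered_mod :: "int \<Rightarrow> int \<Rightarrow> int" where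
  "centered_mod a P = (a + P div 2) mod P - P div 2"

lemma centered_mod_bounds:
  assumes "P > 0"
  shows "- (P div 2) \<le> centered_mod a P" "centered_mod a P < P - P div 2"
  using assms pos_mod_bound[of P "a + P div 2"] by (auto simp: centered_mod_def)

lemma centered_mod_eq: "\<exists>k. centered_mod a P = a + P * k"
  unfolding centered_mod_def
  by (rule exI[of _ "- ((a + P div 2) div P)"]) (simp add: minus_div_mult_eq_mod[symmetric] algebra_simps)

lemma centered_mod_id:
  assumes "- (P div 2) \<le> a" "a < P - P div 2"
  shows "centered_mod a P = a"
  using assms by (simp add: centered_mod_def)

text \<open>Unitarity of the admissible matrices enters only through \<open>sum_mask_fun\<close>,
  with dual sets translated so as to contain 0; \<open>summable_bad\<close> is the remainder bounded
  condition.\<close>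

locale digit_system =
  fixes N :: "nat \<Rightarrow> int" and B L :: "nat \<Rightarrow> int set"
  assumes N_ge_2: "N n \<ge> 2"
    and finite_B: "finite (B n)" and B_nonempty: "B n \<noteq> {}"
    and finite_L: "finite (L n)" and zero_in_L: "0 \<in> L n"
    and sum_mask_fun: "(\<Sum>l\<in>L n. (norm (mask_fun (B n) (x + of_int l / of_int (N n))))\<^sup>2) = 1"
    and summable_bad: "summable (\<lambda>n. real (card (B n - B n \<inter> {0..N n - 1})) / real (card (B n)))"
begin

definition Q :: "nat \<Rightarrow> int" where "Q n = (\<Prod>j<n. N j)"

text \<open>Transform of the convolution of the first \<open>n\<close> levels, with
  \<open>phi 0 = 1\<close>. Level \<open>j\<close> is scaled by \<open>Q (Suc j)\<close>, since
  \<open>Q j\<close> omits the factor \<open>N j\<close>.\<close>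

definition phi :: "nat \<Rightarrow> real \<Rightarrow> complex" where
  "phi n t = (\<Prod>j<n. mask_fun (B j) (t / of_int (Q (Suc j))))"

fun spectrum :: "nat \<Rightarrow> int set" where
  "spectrum 0 = {0}"
| "spectrum (Suc n) = (\<lambda>(a, l). centered_mod (a + Q n * l) (Q (Suc n))) ` (spectrum n \<times> L n)"

lemma N_pos: "N n > 0" using N_ge_2[of n] by simp

lemma Q_Suc: "Q (Suc n) = Q n * N n" by (simp add: Q_def)

lemma Q_ge_power: "Q n \<ge> 2 ^ n"
proof (induction n)
  case (Suc n)
  moreover from this have "0 \<le> Q n" by (rule order_trans[rotated]) simp
  ultimately have "2 ^ n * 2 \<le> Q n * N n" using N_ge_2[of n] by (intro mult_mono) auto
  then show ?case by (simp add: Q_Suc mult.commute)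
qed (simp add: Q_def)

lemma Q_pos: "Q n > 0" using Q_ge_power[of n] by (smt (verit) zero_less_power)

lemma Q_dvd: "m \<le> n \<Longrightarrow> Q m dvd Q n"
  by (auto simp: Q_def intro!: prod_dvd_prod_subset)

lemma Q_at_top: "filterlim (\<lambda>n. real_of_int (Q n)) at_top sequentially"
proof (rule filterlim_at_top_mono[OF filterlim_real_sequentially])
  have "real n \<le> of_int (Q n)" for n
  proof -
    have "int n \<le> Q n"
      using Q_ge_power[of n] of_nat_less_two_power[of n, where 'a=int] by linarith
    then show ?thesis by linarith
  qed
  then show "\<forall>\<^sub>F n in sequentially. real n \<le> real_of_int (Q n)"
    by simp
qed

lemma phi_Suc: "phi (Suc n) t = phi n t * mask_fun (B n) (t / of_int (Q (Suc n)))"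
  by (simp add: phi_def)

lemma phi_0 [simp]: "phi n 0 = 1"
  by (simp add: phi_def mask_fun_0 finite_B B_nonempty)

text \<open>For \<open>j < n\<close>, a shift by a multiple of \<open>Q n\<close> moves
  \<open>t / Q (Suc j)\<close> by an integer, and masks have period 1.\<close>

lemma phi_periodic: "phi n (t + of_int (Q n * k)) = phi n t"
  unfolding phi_def
proof (intro prod.cong refl)
  fix j assume "j \<in> {..<n}"
  then obtain c where c: "Q n = Q (Suc j) * c" using Q_dvd[of "Suc j" n] by auto
  have "(t + of_int (Q n * k)) / of_int (Q (Suc j)) = t / of_int (Q (Suc j)) + of_int (c * k)"
    using Q_pos[of "Suc j"] by (simp add: c field_simps)
  then show "mask_fun (B j) ((t + of_int (Q n * k)) / of_int (Q (Suc j))) = mask_fun (B j) (t / of_int (Q (Suc j)))"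
    by (simp only: mask_fun_add_int)
qed

lemma phi_centered_mod: "phi n (t + of_int (centered_mod a (Q n))) = phi n (t + of_int a)"
proof -
  obtain k where "centered_mod a (Q n) = a + Q n * k" using centered_mod_eq by blast
  then show ?thesis using phi_periodic[of n "t + of_int a" k] by (simp add: add.assoc)
qed

lemma finite_spectrum: "finite (spectrum n)"
  by (induction n) (auto simp: finite_L)

lemma spectrum_bounds: "a \<in> spectrum n \<Longrightarrow> - (Q n div 2) \<le> a \<and> a < Q n - Q n div 2"
proof (cases n)
  case (Suc k)
  moreover assume "a \<in> spectrum n"
  ultimately show ?thesis using centered_mod_bounds Q_pos by auto
qed (simp add: Q_def)

text \<open>An old element reappears as the pair with digit \<open>0 \<in> L n\<close>; it already
  lies in the larger centred window, so the reduction fixes it.\<close>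

lemma spectrum_subset_Suc: "spectrum n \<subseteq> spectrum (Suc n)"
proof
  fix a assume a: "a \<in> spectrum n"
  have "Q n \<le> Q (Suc n)" using N_ge_2[of n] Q_pos[of n] by (simp add: Q_Suc)
  with spectrum_bounds[OF a] have "centered_mod a (Q (Suc n)) = a"
    by (intro centered_mod_id) linarith+
  then show "a \<in> spectrum (Suc n)" using a zero_in_L[of n] by force
qed

lemma spectrum_mono: "m \<le> n \<Longrightarrow> spectrum m \<subseteq> spectrum n"
  using spectrum_subset_Suc by (rule lift_Suc_mono_le)

text \<open>The shift by \<open>Q n * l\<close> is invisible to \<open>phi n\<close> and acts on the
  argument of the new mask as \<open>l / N n\<close>. The inner sum over \<open>l\<close> is
  therefore 1 by \<open>sum_mask_fun\<close>, and the outer sum is the hypothesis.\<close>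

lemma sum_phi_pairs:
  assumes IH: "\<And>t. (\<Sum>a\<in>spectrum n. (norm (phi n (t + of_int a)))\<^sup>2) = 1"
  shows "(\<Sum>(a, l)\<in>spectrum n \<times> L n. (norm (phi (Suc n) (t + of_int (a + Q n * l))))\<^sup>2) = 1"
proof -
  have "(norm (phi (Suc n) (t + of_int (a + Q n * l))))\<^sup>2 = (norm (phi n (t + of_int a)))\<^sup>2 *
     (norm (mask_fun (B n) ((t + of_int a) / of_int (Q (Suc n)) + of_int l / of_int (N n))))\<^sup>2" for a l
  proof -
    have "(t + of_int (a + Q n * l)) / of_int (Q (Suc n)) = (t + of_int a) / of_int (Q (Suc n)) + of_int l / of_int (N n)"
      using Q_pos[of n] N_pos[of n] by (simp add: Q_Suc add_divide_distrib)
    moreover have "phi n (t + of_int (a + Q n * l)) = phi n (t + of_int a)"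
      using phi_periodic[of n "t + of_int a" l] by (simp add: add.assoc)
    ultimately show ?thesis by (simp only: phi_Suc norm_mult power_mult_distrib)
  qed
  then have "(\<Sum>(a, l)\<in>spectrum n \<times> L n. (norm (phi (Suc n) (t + of_int (a + Q n * l))))\<^sup>2)
    = (\<Sum>a\<in>spectrum n. (norm (phi n (t + of_int a)))\<^sup>2 *
     (\<Sum>l\<in>L n. (norm (mask_fun (B n) ((t + of_int a) / of_int (Q (Suc n)) + of_int l / of_int (N n))))\<^sup>2))"
    by (simp only: sum.cartesian_product[symmetric] sum_distrib_left)
  then show ?thesis by (simp add: sum_mask_fun IH)
qed

text \<open>Evaluated at \<open>t = - p\<close>, the identity forbids a second pair congruent to \<open>p\<close>:
  each such pair would contribute a term equal to 1.\<close>

lemma inj_on_centered_mod_pairs: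
  assumes IH: "\<And>t. (\<Sum>a\<in>spectrum n. (norm (phi n (t + of_int a)))\<^sup>2) = 1"
  shows "inj_on (\<lambda>(a, l). centered_mod (a + Q n * l) (Q (Suc n))) (spectrum n \<times> L n)"
proof (rule inj_onI, rule ccontr)
  let ?v = "\<lambda>(a, l). a + Q n * l"
  fix p q assume p: "p \<in> spectrum n \<times> L n" and q: "q \<in> spectrum n \<times> L n" and "p \<noteq> q"
    and "(case p of (a, l) \<Rightarrow> centered_mod (a + Q n * l) (Q (Suc n)))
       = (case q of (a, l) \<Rightarrow> centered_mod (a + Q n * l) (Q (Suc n)))"
  then have eq: "centered_mod (?v p) (Q (Suc n)) = centered_mod (?v q) (Q (Suc n))"
    by (auto split: prod.splits)
  let ?t = "- real_of_int (?v p)"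
  let ?f = "\<lambda>r. (norm (phi (Suc n) (?t + of_int (?v r))))\<^sup>2"
  have "?f q = ?f p"
    using phi_centered_mod[of "Suc n" ?t "?v p"] phi_centered_mod[of "Suc n" ?t "?v q"] eq by simp
  then have "?f p + ?f q = 2" by simp
  moreover have "sum ?f {p, q} \<le> sum ?f (spectrum n \<times> L n)"
    using p q finite_spectrum finite_L by (intro sum_mono2) auto
  moreover have "sum ?f (spectrum n \<times> L n) = 1"
    using sum_phi_pairs[OF IH, of ?t] by (simp add: split_def)
  ultimately show False using \<open>p \<noteq> q\<close> by simp
qed

text \<open>Reduction modulo \<open>Q (Suc n)\<close> is injective on pairs and does not change
  \<open>phi (Suc n)\<close>, so the identity for pairs transfers to the reduced set.\<close>

lemma sum_phi_spectrum: "(\<Sum>a\<in>spectrum n. (norm (phi n (t + of_int a)))\<^sup>2) = 1"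
proof (induction n arbitrary: t)
  case (Suc n)
  show ?case
    using sum_phi_pairs[OF Suc, of t]
    unfolding spectrum.simps sum.reindex[OF inj_on_centered_mod_pairs[OF Suc]]
    by (simp add: o_def split_def phi_centered_mod del: of_int_add of_int_mult)
qed (simp add: phi_def)

text \<open>At \<open>t = - a'\<close> the term of \<open>a'\<close> already exhausts the total 1,
  so every other term vanishes.\<close>

lemma phi_spectrum_orthogonal:
  assumes "a \<in> spectrum n" "a' \<in> spectrum n" "a \<noteq> a'"
  shows "phi n (of_int (a - a')) = 0"
proof -
  let ?f = "\<lambda>b. (norm (phi n (- of_int a' + of_int b)))\<^sup>2"
  have "sum ?f {a, a'} \<le> sum ?f (spectrum n)"
    using assms finite_spectrum by (intro sum_mono2) auto
  then have "sum ?f {a, a'} \<le> 1" unfolding sum_phi_spectrum .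
  then have "?f a \<le> 0" using assms by simp
  then show ?thesis by simp
qed

subsection \<open>Lower bounds for the tail\<close>

definition bad_ratio :: "nat \<Rightarrow> real" where
  "bad_ratio n = real (card (B n - B n \<inter> {0..N n - 1})) / real (card (B n))"

text \<open>Mask after moving every digit outside \<open>{0..N n - 1}\<close> to 0. With such digits
  the rescaled tail lives in [0, 1], which the original digits do not guarantee.\<close>

definition clip_mask :: "nat \<Rightarrow> real \<Rightarrow> complex" where
  "clip_mask n u = (\<Sum>b\<in>B n. cis (- 2 * pi * u * of_int (if b \<in> {0..N n - 1} then b else 0))) / of_nat (card (B n))"

lemma norm_clip_mask_le_1: "norm (clip_mask n u) \<le> 1"
proof -
  have "norm (\<Sum>b\<in>B n. cis (- 2 * pi * u * of_int (if b \<in> {0..N n - 1} then b else 0))) \<le> (\<Sum>b\<in>B n. 1)"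
    by (rule sum_norm_le) simp
  then show ?thesis
    using finite_B B_nonempty by (simp add: clip_mask_def norm_divide divide_le_eq card_gt_0_iff)
qed

lemma norm_mask_clip_mask_diff: "norm (mask_fun (B n) u - clip_mask n u) \<le> 2 * bad_ratio n"
proof -
  have "B n - B n \<inter> {0..N n - 1} = B n \<inter> - {0..N n - 1}" by blast
  then show ?thesis
    using norm_mask_fun_diff_le[of "B n" "- {0..N n - 1}" "\<lambda>b. if b \<in> {0..N n - 1} then b else 0" u] finite_B
    by (simp add: clip_mask_def bad_ratio_def del: atLeastAtMost_iff)
qed

text \<open>The product averages \<open>cis (- 2 * pi * t / Q n * s)\<close> over points \<open>s \<in> [0, 1]\<close> with digit expansions,
  so it lies in every half-plane containing all these values.\<close>

lemma Re_clip_prod_ge: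
  assumes "\<And>s. 0 \<le> s \<Longrightarrow> s \<le> 1 \<Longrightarrow> c \<le> Re (a * cis (- 2 * pi * (t / of_int (Q n)) * s))"
  shows "c \<le> Re (a * (\<Prod>j=n..<n+d. clip_mask j (t / of_int (Q (Suc j)))))"
  using assms
proof (induction d arbitrary: n a)
  \<comment> \<open>The empty product is 1, which matches the instance \<open>s = 0\<close>.\<close>
  case 0
  from 0[of 0] show ?case by simp
next
  case (Suc d)
  define g where "g b = (if b \<in> {0..N n - 1} then b else 0)" for b
  define T where "T = (\<Prod>j=Suc n..<Suc n+d. clip_mask j (t / of_int (Q (Suc j))))"
  let ?w = "\<lambda>b. cis (- 2 * pi * (t / of_int (Q (Suc n))) * of_int (g b))"
  define m where "m = real (card (B n))"
  have m: "m > 0" using finite_B B_nonempty by (simp add: m_def card_gt_0_iff)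
  have "(\<Prod>j=n..<n+Suc d. clip_mask j (t / of_int (Q (Suc j)))) = clip_mask n (t / of_int (Q (Suc n))) * T"
    unfolding T_def by (subst prod.atLeast_Suc_lessThan) auto
  also have "a * \<dots> = (\<Sum>b\<in>B n. (a * ?w b) * T) / complex_of_real m"
    by (simp add: clip_mask_def g_def m_def sum_distrib_left sum_distrib_right mult_ac)
  finally have eq: "Re (a * (\<Prod>j=n..<n+Suc d. clip_mask j (t / of_int (Q (Suc j)))))
     = (\<Sum>b\<in>B n. Re ((a * ?w b) * T)) / m"
    by (simp only: Re_divide_of_real Re_sum)
  have "c \<le> Re ((a * ?w b) * T)" for b
    unfolding T_def
  proof (rule Suc.IH)
    fix s :: real assume s: "0 \<le> s" "s \<le> 1"
    have g: "0 \<le> g b" "g b \<le> N n - 1" using N_pos[of n] by (auto simp: g_def)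
    then have g': "0 \<le> real_of_int (g b)" "real_of_int (g b) \<le> of_int (N n) - 1"
      by (simp, metis g(2) of_int_le_iff of_int_diff of_int_1)
    \<comment> \<open>Splitting off the first digit: \<open>(g b + s) / N n\<close> is again in
      [0, 1], because \<open>g b <= N n - 1\<close> and \<open>s <= 1\<close>.\<close>
    have "c \<le> Re (a * cis (- 2 * pi * (t / of_int (Q n)) * ((of_int (g b) + s) / of_int (N n))))"
      using s g' N_pos[of n] by (intro Suc.prems) (auto simp: field_simps)
    also have "- 2 * pi * (t / of_int (Q n)) * ((of_int (g b) + s) / of_int (N n))
       = - 2 * pi * (t / of_int (Q (Suc n))) * of_int (g b) + - 2 * pi * (t / of_int (Q (Suc n))) * s"
      using Q_pos[of n] N_pos[of n] by (simp add: Q_Suc field_simps)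
    finally show "c \<le> Re (a * ?w b * cis (- 2 * pi * (t / of_int (Q (Suc n))) * s))"
      by (simp only: cis_mult[symmetric] mult.assoc)
  qed
  then have "(\<Sum>b\<in>B n. c) \<le> (\<Sum>b\<in>B n. Re ((a * ?w b) * T))" by (intro sum_mono)
  then have "m * c \<le> (\<Sum>b\<in>B n. Re ((a * ?w b) * T))" by (simp add: m_def)
  then show ?case unfolding eq using m by (simp add: field_simps)
qed

text \<open>The phase \<open>cis (pi * y)\<close> turns the midpoint of [0, 1] to angle 0. As
  \<open>|y| <= 1/3\<close>, all angles stay within \<open>pi / 3\<close>, where the cosine is at
  least 1/2.\<close>

lemma norm_clip_prod_ge:
  assumes "\<bar>t\<bar> \<le> of_int (Q n) / 3"
  shows "1 / 2 \<le> norm (\<Prod>j=n..<n+d. clip_mask j (t / of_int (Q (Suc j))))"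
proof -
  define y where "y = t / of_int (Q n)"
  have y: "\<bar>y\<bar> \<le> 1 / 3" using assms Q_pos[of n] by (simp add: y_def field_simps)
  have "1 / 2 \<le> Re (cis (pi * y) * (\<Prod>j=n..<n+d. clip_mask j (t / of_int (Q (Suc j)))))"
  proof (rule Re_clip_prod_ge)
    fix s :: real assume s: "0 \<le> s" "s \<le> 1"
    have "Re (cis (pi * y) * cis (- 2 * pi * (t / of_int (Q n)) * s)) = cos (pi * (y * (1 - 2 * s)))"
      unfolding cis_mult y_def[symmetric] by (simp add: algebra_simps)
    also have "\<dots> = cos (pi * \<bar>y * (1 - 2 * s)\<bar>)"
      by (cases "y * (1 - 2 * s) \<ge> 0") (simp_all add: abs_if)
    also have "\<dots> \<ge> cos (pi / 3)"
    proof (rule cos_monotone_0_pi_le)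
      have "\<bar>y * (1 - 2 * s)\<bar> \<le> (1 / 3) * 1"
        unfolding abs_mult using y s by (intro mult_mono) auto
      then show "pi * \<bar>y * (1 - 2 * s)\<bar> \<le> pi / 3" by simp
    qed auto
    finally show "1 / 2 \<le> Re (cis (pi * y) * cis (- 2 * pi * (t / of_int (Q n)) * s))"
      by (simp add: cos_60)
  qed
  also have "\<dots> \<le> norm (cis (pi * y) * (\<Prod>j=n..<n+d. clip_mask j (t / of_int (Q (Suc j)))))"
    by (rule complex_Re_le_cmod)
  also have "\<dots> = norm (\<Prod>j=n..<n+d. clip_mask j (t / of_int (Q (Suc j))))"
    by (simp add: norm_mult)
  finally show ?thesis .
qed

text \<open>All factors have modulus at most 1, so replacing masks by clipped masks changes the
  product by at most the sum of the changes of the factors.\<close>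

lemma norm_mask_prod_ge:
  assumes "\<bar>t\<bar> \<le> of_int (Q n) / 3"
  shows "1 / 2 - 2 * (\<Sum>j=n..<n+d. bad_ratio j) \<le> norm (\<Prod>j=n..<n+d. mask_fun (B j) (t / of_int (Q (Suc j))))"
proof -
  let ?M = "\<Prod>j=n..<n+d. mask_fun (B j) (t / of_int (Q (Suc j)))"
  let ?C = "\<Prod>j=n..<n+d. clip_mask j (t / of_int (Q (Suc j)))"
  have "norm (?M - ?C) \<le> (\<Sum>j=n..<n+d. norm (mask_fun (B j) (t / of_int (Q (Suc j))) - clip_mask j (t / of_int (Q (Suc j)))))"
    by (rule norm_prod_diff) (auto simp: norm_mask_fun_le_1 norm_clip_mask_le_1)
  also have "\<dots> \<le> (\<Sum>j=n..<n+d. 2 * bad_ratio j)"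
    by (intro sum_mono norm_mask_clip_mask_diff)
  finally have "norm (?M - ?C) \<le> 2 * (\<Sum>j=n..<n+d. bad_ratio j)" by (simp add: sum_distrib_left)
  then show ?thesis
    using norm_clip_prod_ge[OF assms, of d] norm_triangle_ineq2[of ?C ?M] by (simp add: norm_minus_commute)
qed

lemma phi_add: "phi (n + d) t = phi n t * (\<Prod>j=n..<n+d. mask_fun (B j) (t / of_int (Q (Suc j))))"
  unfolding phi_def by (simp add: lessThan_atLeast0 prod.atLeastLessThan_concat)

text \<open>The first tail factor is at least \<open>1/4 - 2/16 = 1/8\<close> by consecutiveness. As
  \<open>N n >= 2\<close>, the bound \<open>2/3 * Q n\<close> is at most
  \<open>Q (Suc n) / 3\<close>, so the rest of the tail is at least \<open>1/2 - 2/16\<close>, in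
  particular 1/8. The constant 2/3, larger than 1/2, leaves room for translating the spectrum by a
  fixed frequency.\<close>

lemma norm_phi_ge_consecutive:
  assumes gc: "general_consecutive (N n) (B n)"
    and r: "bad_ratio n \<le> 1 / 16" "\<And>d. (\<Sum>j=Suc n..<Suc n+d. bad_ratio j) \<le> 1 / 16"
    and t: "\<bar>t\<bar> \<le> 2 / 3 * of_int (Q n)" and "n < k"
  shows "norm (phi n t) \<le> 64 * norm (phi k t)"
proof -
  define d where "d = k - Suc n"
  have k: "k = Suc n + d" using assms by (simp add: d_def)
  let ?M = "mask_fun (B n) (t / of_int (Q (Suc n)))"
  let ?T = "\<Prod>j=Suc n..<Suc n+d. mask_fun (B j) (t / of_int (Q (Suc j)))"
  have "of_int (N n) * \<bar>t / of_int (Q (Suc n))\<bar> \<le> 2 / 3"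
    using t Q_pos[of n] N_pos[of n] by (simp add: Q_Suc abs_mult field_simps)
  then have M: "1 / 8 \<le> norm ?M"
    using norm_mask_fun_consecutive_ge[OF gc N_pos finite_B B_nonempty, of "t / of_int (Q (Suc n))"] r(1)
    by (simp add: bad_ratio_def)
  have "2 * real_of_int (Q n) \<le> of_int (Q (Suc n))"
  proof -
    have "Q n * 2 \<le> Q n * N n" using N_ge_2[of n] Q_pos[of n] by (intro mult_left_mono) auto
    then have "real_of_int (Q n * 2) \<le> of_int (Q (Suc n))" unfolding Q_Suc of_int_le_iff .
    then show ?thesis by simp
  qed
  then have "\<bar>t\<bar> \<le> of_int (Q (Suc n)) / 3" using t by linarith
  from norm_mask_prod_ge[OF this, of d] r(2)[of d] have T: "1 / 8 \<le> norm ?T" by linarith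
  have "(1 / 8) * (1 / 8) \<le> norm ?M * norm ?T"
    using M T by (intro mult_mono) auto
  then have "norm (phi n t) * (1 / 64) \<le> norm (phi n t) * (norm ?M * norm ?T)"
    by (intro mult_left_mono) auto
  also have "\<dots> = norm (phi k t)"
    unfolding k phi_add phi_Suc by (simp add: norm_mult)
  finally show ?thesis by simp
qed

lemma eventually_tail_small:
  "\<forall>\<^sub>F n in sequentially. bad_ratio n \<le> 1 / 16 \<and> (\<forall>d. (\<Sum>j=Suc n..<Suc n+d. bad_ratio j) \<le> 1 / 16)"
proof -
  have s: "summable bad_ratio" using summable_bad unfolding bad_ratio_def[abs_def] .
  have "\<forall>\<^sub>F n in sequentially. bad_ratio n < 1 / 16"
    using summable_LIMSEQ_zero[OF s] by (rule order_tendstoD) simp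
  moreover from s[unfolded summable_Cauchy, rule_format, of "1/16"] obtain M where
    M: "\<And>m n. m \<ge> M \<Longrightarrow> norm (sum bad_ratio {m..<n}) < 1 / 16" by auto
  have "\<forall>\<^sub>F n in sequentially. \<forall>d. (\<Sum>j=Suc n..<Suc n+d. bad_ratio j) \<le> 1 / 16"
    using eventually_ge_at_top[of M]
  proof eventually_elim
    case (elim n)
    show ?case
    proof
      fix d show "(\<Sum>j=Suc n..<Suc n+d. bad_ratio j) \<le> 1 / 16"
        using M[of "Suc n" "Suc n + d"] elim by simp
    qed
  qed
  ultimately show ?thesis by eventually_elim auto
qed

end


subsection \<open>The limit measure\<close>

text \<open>The factors are realised as independent coordinates on a product space. By
  Borel-Cantelli almost every point has its coordinates in \<open>{0..c n}\<close> from some index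
  on, so the series of coordinates converges. The law of its sum is the weak limit by dominated
  convergence.\<close>

lemma infinite_convolution_exists:
  fixes M \<nu> :: "nat \<Rightarrow> real measure"
  assumes rd: "\<And>n. real_distribution (M n)"
    and c: "summable c" and bad: "summable (\<lambda>n. measure (M n) (- {0..c n}))"
    and \<nu>_0: "\<nu> 0 = M 0" and \<nu>_Suc: "\<And>n. \<nu> (Suc n) = convolution (\<nu> n) (M (Suc n))"
  obtains \<mu> where "real_distribution \<mu>" "weak_converges \<nu> \<mu>"
proof -
  interpret M: real_distribution "M n" for n by (rule rd)
  interpret product_prob_space M "UNIV :: nat set" by unfold_locales
  let ?\<Omega> = "PiM UNIV M"
  have coord_M: "(\<lambda>\<omega>. \<omega> i) \<in> measurable ?\<Omega> (M i)" for i
    by (rule measurable_component_singleton) simp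
  have coord [measurable]: "(\<lambda>\<omega>. \<omega> i) \<in> borel_measurable ?\<Omega>" for i
    using coord_M[of i] by (simp cong: measurable_cong_sets)
  have distr_coord: "distr ?\<Omega> borel (\<lambda>\<omega>. \<omega> i) = M i" for i
    using PiM_component[of i] by (simp cong: distr_cong)
  have indep: "P.indep_vars (\<lambda>_. borel) (\<lambda>i \<omega>. \<omega> i) UNIV"
  proof (subst P.indep_vars_iff_distr_eq_PiM')
    have s: "sets (\<Pi>\<^sub>M i\<in>(UNIV::nat set). (borel :: real measure)) = sets ?\<Omega>"
      by (intro sets_PiM_cong) auto
    have "distr ?\<Omega> (\<Pi>\<^sub>M i\<in>(UNIV::nat set). borel) (\<lambda>x. \<lambda>i\<in>UNIV. x i) = distr ?\<Omega> ?\<Omega> (\<lambda>x. x)"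
      using s by (intro distr_cong) auto
    also have "\<dots> = ?\<Omega>" by (rule distr_id)
    also have "\<dots> = (\<Pi>\<^sub>M i\<in>UNIV. distr ?\<Omega> borel (\<lambda>\<omega>. \<omega> i))" by (simp add: distr_coord)
    finally show "distr ?\<Omega> (\<Pi>\<^sub>M i\<in>(UNIV::nat set). borel) (\<lambda>x. \<lambda>i\<in>UNIV. x i)
       = (\<Pi>\<^sub>M i\<in>UNIV. distr ?\<Omega> borel (\<lambda>\<omega>. \<omega> i))" .
  qed auto
  define S where "S n \<omega> = (\<Sum>i\<le>n. \<omega> i)" for n and \<omega> :: "nat \<Rightarrow> real"
  have S_meas [measurable]: "S n \<in> borel_measurable ?\<Omega>" for n unfolding S_def by measurable
  have distr_S: "distr ?\<Omega> borel (S n) = \<nu> n" for n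
  proof (induction n)
    case 0 then show ?case using distr_coord[of 0] by (simp add: S_def[abs_def] \<nu>_0)
  next
    case (Suc n)
    have "P.indep_var borel (\<lambda>\<omega>. \<omega> (Suc n)) borel (\<lambda>\<omega>. \<Sum>i\<in>{..n}. \<omega> i)"
      by (rule P.indep_vars_sum) (auto intro: P.indep_vars_subset[OF indep])
    then have "P.indep_var borel (\<lambda>\<omega>. \<omega> (Suc n)) borel (S n)" by (simp add: S_def[abs_def])
    then have "distr ?\<Omega> borel (\<lambda>\<omega>. \<omega> (Suc n) + S n \<omega>) = convolution (M (Suc n)) (distr ?\<Omega> borel (S n))"
      by (subst P.sum_indep_random_variable) (auto simp: distr_coord)
    also have "(\<lambda>\<omega>. \<omega> (Suc n) + S n \<omega>) = S (Suc n)" by (simp add: S_def fun_eq_iff)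
    also have "convolution (M (Suc n)) (distr ?\<Omega> borel (S n)) = convolution (distr ?\<Omega> borel (S n)) (M (Suc n))"
      by (rule convolution_commutative) (auto intro: P.finite_measure_distr M.finite_measure_axioms)
    finally show ?case by (simp add: Suc \<nu>_Suc)
  qed
  have "AE \<omega> in ?\<Omega>. \<forall>\<^sub>F n in sequentially. \<omega> \<in> space ?\<Omega> - {\<omega> \<in> space ?\<Omega>. \<omega> n \<notin> {0..c n}}"
  proof (rule borel_cantelli_AE1)
    have "measure ?\<Omega> {\<omega> \<in> space ?\<Omega>. \<omega> n \<notin> {0..c n}} = measure (M n) (- {0..c n})" for n
    proof -
      have "measure (M n) (- {0..c n}) = measure (distr ?\<Omega> borel (\<lambda>\<omega>. \<omega> n)) (- {0..c n})"
        by (simp add: distr_coord)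
      also have "\<dots> = measure ?\<Omega> {\<omega> \<in> space ?\<Omega>. \<omega> n \<notin> {0..c n}}"
        by (subst measure_distr) (auto intro!: arg_cong[where f="measure ?\<Omega>"])
      finally show ?thesis by simp
    qed
    then show "summable (\<lambda>n. measure ?\<Omega> {\<omega> \<in> space ?\<Omega>. \<omega> n \<notin> {0..c n}})" using bad by simp
  qed (auto simp: P.emeasure_eq_measure)
  then have conv: "AE \<omega> in ?\<Omega>. (\<lambda>n. S n \<omega>) \<longlonglongrightarrow> suminf \<omega>"
  proof eventually_elim
    case (elim \<omega>)
    have "summable \<omega>"
      by (rule summable_comparison_test_ev[OF _ c]) (use elim in \<open>eventually_elim, auto\<close>)
    then show ?case unfolding S_def by (rule summable_LIMSEQ')
  qed
  \<comment> \<open>Where the series diverges \<open>suminf\<close> has an unspecified value; it is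
    measurable all the same, and that set is null by \<open>conv\<close>.\<close>
  have [measurable]: "suminf \<in> borel_measurable ?\<Omega>"
    by (rule borel_measurable_suminf) measurable
  show thesis
  proof
    show "real_distribution (distr ?\<Omega> borel suminf)"
      by (intro P.real_distribution_distr) measurable
    show "weak_converges \<nu> (distr ?\<Omega> borel suminf)"
      unfolding weak_converges_def
    proof (intro allI impI)
      fix f :: "real \<Rightarrow> real" assume f: "continuous_on UNIV f" "bounded (range f)"
      then have [measurable]: "f \<in> borel_measurable borel" by (intro borel_measurable_continuous_onI)
      from f(2) obtain K where K: "\<And>x. norm (f x) \<le> K" by (auto simp: bounded_iff)
      have "(\<lambda>n. \<integral>\<omega>. f (S n \<omega>) \<partial>?\<Omega>) \<longlonglongrightarrow> (\<integral>\<omega>. f (suminf \<omega>) \<partial>?\<Omega>)"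
      proof (rule integral_dominated_convergence[where w="\<lambda>_. K"])
        show "AE \<omega> in ?\<Omega>. (\<lambda>n. f (S n \<omega>)) \<longlonglongrightarrow> f (suminf \<omega>)"
          using conv
        proof eventually_elim
          case (elim \<omega>)
          show ?case by (rule continuous_on_tendsto_compose[OF f(1) elim]) auto
        qed
      qed (use K in auto)
      then show "(\<lambda>n. integral\<^sup>L (\<nu> n) f) \<longlonglongrightarrow> integral\<^sup>L (distr ?\<Omega> borel suminf) f"
        by (simp add: distr_S[symmetric] integral_distr)
    qed
  qed
qed

section \<open>Fourier transforms of the partial convolutions and of their limit\<close>

lemma char_convolution:
  assumes "real_distribution M1" "real_distribution M2"
  shows "char (convolution M1 M2) t = char M1 t * char M2 t"
proof -
  interpret M1: real_distribution M1 by fact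
  interpret M2: real_distribution M2 by fact
  interpret P: pair_prob_space M1 M2 ..
  have int: "integrable (M1 \<Otimes>\<^sub>M M2) (\<lambda>z. iexp (t * (fst z + snd z)))"
    by (rule P.integrable_const_bound[of _ 1]) auto
  have "char (convolution M1 M2) t = (CLINT z|M1 \<Otimes>\<^sub>M M2. iexp (t * (fst z + snd z)))"
    unfolding char_def convolution_def by (subst integral_distr) (auto simp: split_def)
  also have "\<dots> = (CLINT x|M1. (CLINT y|M2. iexp (t * (x + y))))"
    using P.integral_fst'[OF int] by simp
  also have "\<dots> = (CLINT x|M1. iexp (t * x) * char M2 t)"
    unfolding char_def by (simp add: distrib_left exp_add)
  also have "\<dots> = char M1 t * char M2 t" unfolding char_def by simp
  finally show ?thesis .
qed

lemma real_distribution_convolution: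
  assumes "real_distribution M1" "real_distribution M2"
  shows "real_distribution (convolution M1 M2)"
proof -
  interpret M1: real_distribution M1 by fact
  interpret M2: real_distribution M2 by fact
  interpret P: pair_prob_space M1 M2 ..
  show ?thesis unfolding convolution_def by (rule P.real_distribution_distr) auto
qed

lemma real_distribution_delta_set: "real_distribution (delta_set A)"
  unfolding delta_set_def by (rule prob_space.real_distribution_distr) (auto intro: prob_space_measure_pmf)

text \<open>Weak convergence is stated for real test functions, so cosine and sine are treated
  separately.\<close>

lemma weak_converges_char:
  assumes "\<And>n. real_distribution (\<nu> n)" "real_distribution \<mu>" "weak_converges \<nu> \<mu>"
  shows "(\<lambda>n. char (\<nu> n) t) \<longlonglongrightarrow> char \<mu> t"
proof -
  have eq: "char M t = Complex (\<integral>x. cos (t * x) \<partial>M) (\<integral>x. sin (t * x) \<partial>M)" if "real_distribution M" for M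
  proof -
    interpret real_distribution M by fact
    have "integrable M (\<lambda>x. iexp (t * x))" by (rule integrable_iexp) auto
    from integral_Re[OF this] integral_Im[OF this] show ?thesis
      by (simp add: char_def complex_eq_iff Re_exp Im_exp)
  qed
  have b: "bounded (range (\<lambda>x. cos (t * x)))" "bounded (range (\<lambda>x. sin (t * x)))"
    by (auto simp: bounded_iff intro!: exI[of _ 1])
  have "(\<lambda>n. Complex (\<integral>x. cos (t * x) \<partial>\<nu> n) (\<integral>x. sin (t * x) \<partial>\<nu> n)) \<longlonglongrightarrow>
     Complex (\<integral>x. cos (t * x) \<partial>\<mu>) (\<integral>x. sin (t * x) \<partial>\<mu>)"
  proof (intro tendsto_Complex)
    show "(\<lambda>n. \<integral>x. cos (t * x) \<partial>\<nu> n) \<longlonglongrightarrow> (\<integral>x. cos (t * x) \<partial>\<mu>)"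
      using assms(3) b(1) unfolding weak_converges_def
      by (elim allE[of _ "\<lambda>x. cos (t * x)"]) (auto intro!: continuous_intros)
    show "(\<lambda>n. \<integral>x. sin (t * x) \<partial>\<nu> n) \<longlonglongrightarrow> (\<integral>x. sin (t * x) \<partial>\<mu>)"
      using assms(3) b(2) unfolding weak_converges_def
      by (elim allE[of _ "\<lambda>x. sin (t * x)"]) (auto intro!: continuous_intros)
  qed
  then show ?thesis by (simp add: eq assms(1,2))
qed

context digit_system
begin

definition scaled_digits :: "nat \<Rightarrow> real set" where
  "scaled_digits n = (\<lambda>b. real_of_int b / real_of_int (partial_prod N n)) ` B n"

lemma partial_prod_eq: "partial_prod N n = Q (Suc n)"
  by (simp add: partial_prod_def Q_def atMost_atLeast0 lessThan_Suc_atMost)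

lemma finite_scaled_digits: "finite (scaled_digits n)" "scaled_digits n \<noteq> {}"
  by (auto simp: scaled_digits_def finite_B B_nonempty)

lemma inj_scaled: "inj_on (\<lambda>b. real_of_int b / real_of_int (partial_prod N n)) A"
  using Q_pos[of "Suc n"] by (auto simp: inj_on_def partial_prod_eq)

text \<open>The argument \<open>- 2 * pi * t\<close> converts the convention of \<open>char\<close>
  into that of \<open>expfun\<close>. Injectivity of the scaling keeps all weights equal to
  \<open>1 / card (B n)\<close>.\<close>

lemma char_delta_scaled_digits:
  "char (delta_set (scaled_digits n)) (- 2 * pi * t) = mask_fun (B n) (t / of_int (Q (Suc n)))"
proof -
  have "char (delta_set (scaled_digits n)) (- 2 * pi * t)
      = (CLINT x|measure_pmf (pmf_of_set (scaled_digits n)). iexp (- 2 * pi * t * x))"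
    unfolding char_def delta_set_def by (subst integral_distr) auto
  also have "\<dots> = (\<Sum>x\<in>scaled_digits n. iexp (- 2 * pi * t * x)) / of_nat (card (scaled_digits n))"
    using finite_scaled_digits
    by (subst integral_measure_pmf[of "scaled_digits n"])
       (auto simp: pmf_of_set scaleR_conv_of_real sum_divide_distrib)
  also have "\<dots> = mask_fun (B n) (t / of_int (Q (Suc n)))"
    unfolding scaled_digits_def mask_fun_def card_image[OF inj_scaled] sum.reindex[OF inj_scaled]
    by (simp add: partial_prod_eq cis_conv_exp o_def mult_ac)
  finally show ?thesis .
qed

lemma real_distribution_conv_partial: "real_distribution (conv_partial N B n)"
  by (induction n) (auto intro: real_distribution_delta_set real_distribution_convolution)

text \<open>\<open>conv_partial\<close> at index \<open>n\<close> has \<open>n + 1\<close> factors,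
  hence the \<open>Suc\<close>.\<close>

lemma char_conv_partial: "char (conv_partial N B n) (- 2 * pi * t) = phi (Suc n) t"
proof (induction n)
  case 0
  then show ?case using char_delta_scaled_digits[of 0 t] by (simp add: phi_def scaled_digits_def)
next
  case (Suc n)
  then show ?case
    using char_delta_scaled_digits[of "Suc n" t]
    by (simp add: char_convolution real_distribution_conv_partial real_distribution_delta_set
        phi_Suc[of "Suc n"] scaled_digits_def)
qed

text \<open>A digit in \<open>{0..N n - 1}\<close> divided by \<open>Q (Suc n) = Q n * N n\<close>
  lands in \<open>[0, 1 / Q n]\<close>, so only the exceptional digits carry mass outside. This
  feeds the Borel-Cantelli argument.\<close>

lemma measure_bad_digits: "measure (delta_set (scaled_digits n)) (- {0..1 / of_int (Q n)}) \<le> bad_ratio n"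
proof -
  have "measure (delta_set (scaled_digits n)) (- {0..1 / of_int (Q n)})
      = measure (measure_pmf (pmf_of_set (scaled_digits n))) (- {0..1 / of_int (Q n)})"
    unfolding delta_set_def by (subst measure_distr) auto
  also have "\<dots> = real (card (scaled_digits n \<inter> - {0..1 / of_int (Q n)})) / real (card (scaled_digits n))"
    using finite_scaled_digits by (subst measure_pmf_of_set) auto
  also have "card (scaled_digits n) = card (B n)"
    unfolding scaled_digits_def by (rule card_image[OF inj_scaled])
  also have "card (scaled_digits n \<inter> - {0..1 / of_int (Q n)})
     \<le> card ((\<lambda>b. real_of_int b / real_of_int (partial_prod N n)) ` (B n - B n \<inter> {0..N n - 1}))"
  proof (rule card_mono)
    show "scaled_digits n \<inter> - {0..1 / of_int (Q n)}
       \<subseteq> (\<lambda>b. real_of_int b / real_of_int (partial_prod N n)) ` (B n - B n \<inter> {0..N n - 1})"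
    proof
      fix x assume x: "x \<in> scaled_digits n \<inter> - {0..1 / of_int (Q n)}"
      then obtain b where b: "b \<in> B n" "x = of_int b / of_int (Q (Suc n))"
        by (auto simp: scaled_digits_def partial_prod_eq)
      have "b \<notin> {0..N n - 1}"
      proof
        assume "b \<in> {0..N n - 1}"
        then have "0 \<le> real_of_int b" "real_of_int b \<le> real_of_int (N n)" by auto
        then have "x \<in> {0..1 / of_int (Q n)}"
          using Q_pos[of n] N_pos[of n] unfolding b(2) Q_Suc by (auto simp: field_simps)
        with x show False by simp
      qed
      with b show "x \<in> (\<lambda>b. real_of_int b / real_of_int (partial_prod N n)) ` (B n - B n \<inter> {0..N n - 1})"
        by (auto simp: partial_prod_eq)
    qed
  qed (simp add: finite_B)
  also have "\<dots> = card (B n - B n \<inter> {0..N n - 1})" by (rule card_image[OF inj_scaled])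
  finally show ?thesis by (simp add: bad_ratio_def divide_right_mono)
qed

lemma summable_inverse_Q: "summable (\<lambda>n. 1 / real_of_int (Q n))"
proof (rule summable_comparison_test')
  show "summable (\<lambda>n. (1 / 2 :: real) ^ n)" by (simp add: summable_geometric)
  fix n
  have "2 ^ n \<le> real_of_int (Q n)" using Q_ge_power[of n] by (metis of_int_le_iff of_int_numeral of_int_power)
  then show "norm (1 / real_of_int (Q n)) \<le> (1 / 2) ^ n"
    using Q_pos[of n] by (simp add: power_divide frac_le)
qed

lemma conv_partial_weak_limit:
  obtains \<mu> where "real_distribution \<mu>" "weak_converges (conv_partial N B) \<mu>"
    "\<And>t. (\<lambda>n. phi n t) \<longlonglongrightarrow> char \<mu> (- 2 * pi * t)"
proof -
  have summable_r: "summable bad_ratio" using summable_bad unfolding bad_ratio_def[abs_def] .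
  have "summable (\<lambda>n. measure (delta_set (scaled_digits n)) (- {0..1 / of_int (Q n)}))"
    by (rule summable_comparison_test'[OF summable_r]) (simp add: measure_bad_digits)
  from infinite_convolution_exists[OF real_distribution_delta_set summable_inverse_Q this,
      of "conv_partial N B"]
  obtain \<mu> where \<mu>: "real_distribution \<mu>" "weak_converges (conv_partial N B) \<mu>"
    by (auto simp: scaled_digits_def)
  moreover have "(\<lambda>n. phi n t) \<longlonglongrightarrow> char \<mu> (- 2 * pi * t)" for t
    using weak_converges_char[OF real_distribution_conv_partial \<mu>, of "- 2 * pi * t"]
    unfolding char_conv_partial by (rule LIMSEQ_imp_Suc)
  ultimately show thesis by (rule that)
qed

end


subsection \<open>Completeness from Parseval's identity\<close>

lemma borel_measurable_cnj [measurable (raw)]: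
  "f \<in> borel_measurable M \<Longrightarrow> (\<lambda>x. cnj (f x)) \<in> borel_measurable M"
  by (rule borel_measurable_continuous_on[of cnj]) (auto intro: continuous_intros)

text \<open>The positive and negative parts have equal mass \<open>c\<close> by the case
  \<open>t = 0\<close>. If \<open>c > 0\<close>, dividing by \<open>c\<close> gives two probability
  densities with the same characteristic function, and Levy's uniqueness theorem identifies them; if
  \<open>c = 0\<close>, both parts vanish.\<close>

lemma AE_zero_if_fourier_zero_real:
  fixes g :: "real \<Rightarrow> real"
  assumes "real_distribution \<mu>" and g: "integrable \<mu> g"
    and zero: "\<And>t. (CLINT x|\<mu>. g x *\<^sub>R iexp (t * x)) = 0"
  shows "AE x in \<mu>. g x = 0"
proof -
  interpret real_distribution \<mu> by fact
  define p where "p x = max 0 (g x)" for x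
  define q where "q x = max 0 (- g x)" for x
  have pq: "g x = p x - q x" for x by (simp add: p_def q_def max_def)
  have [measurable]: "g \<in> borel_measurable borel" using borel_measurable_integrable[OF g] by simp
  have pi: "integrable \<mu> p" and qi: "integrable \<mu> q"
    unfolding p_def[abs_def] q_def[abs_def] using g by auto
  have [measurable]: "p \<in> borel_measurable borel" "q \<in> borel_measurable borel"
    unfolding p_def[abs_def] q_def[abs_def] by auto
  have p0: "p x \<ge> 0" and q0: "q x \<ge> 0" for x by (auto simp: p_def q_def)
  define c where "c = integral\<^sup>L \<mu> p"
  have "complex_of_real (integral\<^sup>L \<mu> g) = 0" using zero[of 0] by (simp add: scaleR_conv_of_real)
  then have "integral\<^sup>L \<mu> g = 0" by simp
  then have cq: "integral\<^sup>L \<mu> q = c" unfolding c_def pq using pi qi by simp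
  have c0: "c \<ge> 0" unfolding c_def using p0 by simp
  show ?thesis
  proof (cases "c = 0")
    case True
    then have "AE x in \<mu>. p x = 0" "AE x in \<mu>. q x = 0"
      using integral_nonneg_eq_0_iff_AE[OF pi] integral_nonneg_eq_0_iff_AE[OF qi] p0 q0 cq c_def by auto
    then show ?thesis by eventually_elim (simp add: pq)
  next
    case False
    with c0 have c: "c > 0" by simp
    have rd: "real_distribution (density \<mu> (\<lambda>x. ennreal (w x / c)))"
      and ch: "\<And>t. char (density \<mu> (\<lambda>x. ennreal (w x / c))) t = (CLINT x|\<mu>. w x *\<^sub>R iexp (t * x)) / c"
      if w: "integrable \<mu> w" "\<And>x. w x \<ge> 0" "integral\<^sup>L \<mu> w = c" for w
    proof -
      have [measurable]: "w \<in> borel_measurable borel" using borel_measurable_integrable[OF w(1)] by simp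
      have "emeasure (density \<mu> (\<lambda>x. ennreal (w x / c))) UNIV = (\<integral>\<^sup>+x. ennreal (w x / c) \<partial>\<mu>)"
        by (subst emeasure_density) auto
      also have "\<dots> = ennreal (\<integral>x. w x / c \<partial>\<mu>)"
        using w c by (intro nn_integral_eq_integral) auto
      also have "\<dots> = 1" using w c by simp
      finally show "real_distribution (density \<mu> (\<lambda>x. ennreal (w x / c)))"
        by (intro real_distribution.intro prob_spaceI real_distribution_axioms.intro) auto
      fix t
      have "char (density \<mu> (\<lambda>x. ennreal (w x / c))) t = (CLINT x|\<mu>. (w x / c) *\<^sub>R iexp (t * x))"
        unfolding char_def using w c by (subst integral_density) auto
      also have "\<dots> = (CLINT x|\<mu>. (w x *\<^sub>R iexp (t * x)) / complex_of_real c)"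
        by (intro Bochner_Integration.integral_cong) (auto simp: scaleR_conv_of_real)
      finally show "char (density \<mu> (\<lambda>x. ennreal (w x / c))) t = (CLINT x|\<mu>. w x *\<^sub>R iexp (t * x)) / c"
        by simp
    qed
    have wint: "integrable \<mu> (\<lambda>x. w x *\<^sub>R iexp (t * x))" if "integrable \<mu> w" for w t
      using that borel_measurable_integrable[OF that]
      by (intro Bochner_Integration.integrable_bound[OF that]) auto
    have "char (density \<mu> (\<lambda>x. ennreal (p x / c))) = char (density \<mu> (\<lambda>x. ennreal (q x / c)))"
    proof
      fix t
      have "(CLINT x|\<mu>. p x *\<^sub>R iexp (t * x)) - (CLINT x|\<mu>. q x *\<^sub>R iexp (t * x)) = (CLINT x|\<mu>. g x *\<^sub>R iexp (t * x))"
        unfolding pq scaleR_diff_left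
        by (rule Bochner_Integration.integral_diff[symmetric]) (rule wint pi qi)+
      then show "char (density \<mu> (\<lambda>x. ennreal (p x / c))) t = char (density \<mu> (\<lambda>x. ennreal (q x / c))) t"
        using zero[of t] ch[OF pi p0 c_def[symmetric]] ch[OF qi q0 cq] by simp
    qed
    then have "density \<mu> (\<lambda>x. ennreal (p x / c)) = density \<mu> (\<lambda>x. ennreal (q x / c))"
      by (intro Levy_uniqueness rd pi qi p0 q0 cq c_def[symmetric])
    then have "AE x in \<mu>. ennreal (p x / c) = ennreal (q x / c)"
      by (subst density_unique_iff[symmetric]) auto
    then show ?thesis
      by eventually_elim (use c p0 q0 in \<open>auto simp: pq ennreal_inj\<close>)
  qed
qed

text \<open>The transform of \<open>cnj f\<close> at \<open>t\<close> is the conjugate of that of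
  \<open>f\<close> at \<open>- t\<close>, so real and imaginary part have vanishing transforms as
  well.\<close>

lemma AE_zero_if_fourier_zero:
  fixes f :: "real \<Rightarrow> complex"
  assumes rd: "real_distribution \<mu>" and f: "integrable \<mu> f"
    and zero: "\<And>t. (CLINT x|\<mu>. f x * iexp (t * x)) = 0"
  shows "AE x in \<mu>. f x = 0"
proof -
  interpret real_distribution \<mu> by fact
  have [measurable]: "f \<in> borel_measurable borel" using borel_measurable_integrable[OF f] by simp
  have int: "integrable \<mu> (\<lambda>x. f x * iexp (t * x))" for t
    by (intro Bochner_Integration.integrable_bound[OF f]) (auto simp: norm_mult)
  have int': "integrable \<mu> (\<lambda>x. cnj (f x) * iexp (t * x))" for t
    by (intro Bochner_Integration.integrable_bound[OF f]) (auto simp: norm_mult)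
  have zero': "(CLINT x|\<mu>. cnj (f x) * iexp (t * x)) = 0" for t
  proof -
    have "(CLINT x|\<mu>. cnj (f x) * iexp (t * x)) = (CLINT x|\<mu>. cnj (f x * iexp ((- t) * x)))"
      by (intro Bochner_Integration.integral_cong) (auto simp: exp_cnj)
    also have "\<dots> = cnj (CLINT x|\<mu>. f x * iexp ((- t) * x))" by (rule Bochner_Integration.integral_cnj)
    finally show ?thesis using zero[of "- t"] by simp
  qed
  have re: "(CLINT x|\<mu>. Re (f x) *\<^sub>R iexp (t * x)) = 0" for t
  proof -
    have eq: "Re (f x) *\<^sub>R iexp (t * x) = (f x * iexp (t * x) + cnj (f x) * iexp (t * x)) / 2" for x
      unfolding distrib_right[symmetric] complex_add_cnj by (simp add: scaleR_conv_of_real)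
    show ?thesis unfolding eq using int[of t] int'[of t] zero[of t] zero'[of t] by (simp del: of_real_mult)
  qed
  have im: "(CLINT x|\<mu>. Im (f x) *\<^sub>R iexp (t * x)) = 0" for t
  proof -
    have eq: "Im (f x) *\<^sub>R iexp (t * x) = (f x * iexp (t * x) - cnj (f x) * iexp (t * x)) / (2 * \<i>)" for x
      unfolding left_diff_distrib[symmetric] complex_diff_cnj by (simp add: scaleR_conv_of_real field_simps)
    show ?thesis unfolding eq using int[of t] int'[of t] zero[of t] zero'[of t] by (simp del: of_real_mult)
  qed
  have "AE x in \<mu>. Re (f x) = 0" "AE x in \<mu>. Im (f x) = 0"
    using re im f by (auto intro!: AE_zero_if_fourier_zero_real[OF rd])
  then show ?thesis by eventually_elim (simp add: complex_eq_iff)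
qed

lemma expfun_eq_iexp: "expfun t x = iexp ((- 2 * pi * t) * x)"
  by (simp add: expfun_def cis_conv_exp mult_ac)

lemma norm_expfun [simp]: "norm (expfun t x) = 1"
  by (simp add: expfun_def)

lemma expfun_mult_cnj: "expfun t x * cnj (expfun s x) = expfun (t - s) x"
  by (simp add: expfun_def cis_cnj cis_mult algebra_simps)

lemma borel_measurable_expfun [measurable]: "expfun t \<in> borel_measurable borel"
  unfolding expfun_def by (intro borel_measurable_continuous_onI continuous_intros)

lemma (in real_distribution) integral_expfun_mult_cnj:
  "(CLINT x|M. expfun t x * cnj (expfun s x)) = char M (- 2 * pi * (t - s))"
  unfolding char_def expfun_mult_cnj unfolding expfun_eq_iexp ..

lemma (in real_distribution) bounded_integrable:
  fixes f :: "real \<Rightarrow> complex"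
  assumes "f \<in> borel_measurable borel" "\<And>x. norm (f x) \<le> K"
  shows "integrable M f"
  using assms by (intro integrable_const_bound[of _ K]) auto

text \<open>Parseval's identity for each exponential alone suffices for completeness: it puts every
  exponential into the closed span, and exponentials separate integrable functions.\<close>

lemma spectral_measureI_Parseval:
  assumes rd: "real_distribution \<mu>" and count: "countable \<Lambda>"
    and orth: "\<And>a b. a \<in> \<Lambda> \<Longrightarrow> b \<in> \<Lambda> \<Longrightarrow> a \<noteq> b \<Longrightarrow> char \<mu> (- 2 * pi * (a - b)) = 0"
    and Parseval: "\<And>t \<eta>. \<eta> > 0 \<Longrightarrow> \<exists>F\<subseteq>\<Lambda>. finite F \<and>
      1 - \<eta> \<le> (\<Sum>a\<in>F. (norm (char \<mu> (- 2 * pi * (t - a))))\<^sup>2)"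
  shows "spectral_measure \<mu>"
proof -
  interpret real_distribution \<mu> by fact
  have on: "(CLINT x|\<mu>. expfun a x * cnj (expfun b x)) = (if a = b then 1 else 0)"
    if "a \<in> \<Lambda>" "b \<in> \<Lambda>" for a b
    using orth[OF that] by (auto simp: integral_expfun_mult_cnj char_zero)
  have "AE x in \<mu>. f x = 0"
    if f: "square_integrable \<mu> f" and f0: "\<And>a. a \<in> \<Lambda> \<Longrightarrow> (CLINT x|\<mu>. f x * cnj (expfun a x)) = 0" for f
  proof (rule AE_zero_if_fourier_zero[OF rd])
    have [measurable]: "f \<in> borel_measurable borel" and f2: "integrable \<mu> (\<lambda>x. (norm (f x))\<^sup>2)"
      using f by (auto simp: square_integrable_def)
    define A where "A = (\<integral>x. (norm (f x))\<^sup>2 \<partial>\<mu>)"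
    show fi: "integrable \<mu> f"
    proof (rule Bochner_Integration.integrable_bound)
      show "integrable \<mu> (\<lambda>x. 1 + (norm (f x))\<^sup>2)" using f2 by simp
      have "norm z \<le> 1 + (norm z)\<^sup>2" for z :: complex
        using sum_squares_ge_zero[of "norm z - 1" 0] by (simp add: power2_eq_square algebra_simps)
           (smt (verit) norm_ge_zero mult_nonneg_nonneg)
      then show "AE x in \<mu>. norm (f x) \<le> norm (1 + (norm (f x))\<^sup>2)" by simp
    qed simp
    have fe: "integrable \<mu> (\<lambda>x. f x * cnj (expfun t x))" for t
      by (intro Bochner_Integration.integrable_bound[OF fi]) (auto simp: norm_mult)
    \<comment> \<open>Here \<open>h\<close> is the projection of \<open>expfun t\<close> onto the
      span of the exponentials in \<open>F\<close>. The squared norm of the remainder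
      \<open>g\<close> is the Parseval defect, at most \<open>s\<^sup>2\<close>, and
      \<open>f\<close> is orthogonal to \<open>h\<close>, so only \<open>g\<close> pairs with
      \<open>f\<close>.\<close>
    have le: "norm (CLINT x|\<mu>. f x * cnj (expfun t x)) \<le> s * (A + 1) / 2" if s: "s > 0" for s t
    proof -
      from Parseval[of "s\<^sup>2" t] s obtain F where F: "F \<subseteq> \<Lambda>" "finite F"
        and P: "1 - s\<^sup>2 \<le> (\<Sum>a\<in>F. (norm (char \<mu> (- 2 * pi * (t - a))))\<^sup>2)" by auto
      define c where "c a = char \<mu> (- 2 * pi * (t - a))" for a
      have c: "(CLINT x|\<mu>. expfun t x * cnj (expfun a x)) = c a" for a
        by (simp add: integral_expfun_mult_cnj c_def)
      have c': "(CLINT x|\<mu>. expfun a x * cnj (expfun t x)) = cnj (c a)" for a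
        unfolding c[symmetric] Bochner_Integration.integral_cnj[symmetric]
        by (intro Bochner_Integration.integral_cong) (auto simp: mult.commute)
      define h where "h x = (\<Sum>a\<in>F. c a * expfun a x)" for x
      define g where "g x = expfun t x - h x" for x
      have [measurable]: "h \<in> borel_measurable borel" "g \<in> borel_measurable borel"
        unfolding h_def[abs_def] g_def[abs_def] by measurable
      have hb: "norm (h x) \<le> (\<Sum>a\<in>F. norm (c a))" for x
        unfolding h_def by (rule sum_norm_le) (simp add: norm_mult)
      have gb: "norm (g x) \<le> 1 + (\<Sum>a\<in>F. norm (c a))" for x
        unfolding g_def using norm_triangle_ineq4[of "expfun t x" "h x"] hb[of x] by simp
      have ei: "integrable \<mu> (\<lambda>x. expfun a x * cnj (expfun b x))" for a b
        by (rule bounded_integrable[of _ 1]) (auto simp: norm_mult)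
      have g2: "integrable \<mu> (\<lambda>x. (norm (g x))\<^sup>2)"
        using gb by (intro integrable_const_bound[of _ "(1 + (\<Sum>a\<in>F. norm (c a)))\<^sup>2"]) (auto intro!: power_mono)
      \<comment> \<open>Bessel's equality: the square is expanded and the double sum collapses by
        orthonormality.\<close>
      have "complex_of_real (\<integral>x. (norm (g x))\<^sup>2 \<partial>\<mu>) = (CLINT x|\<mu>. g x * cnj (g x))"
        unfolding complex_norm_square[symmetric] integral_complex_of_real ..
      also have "(\<lambda>x. g x * cnj (g x)) = (\<lambda>x. expfun t x * cnj (expfun t x)
          - (\<Sum>a\<in>F. cnj (c a) * (expfun t x * cnj (expfun a x)))
          - (\<Sum>a\<in>F. c a * (expfun a x * cnj (expfun t x)))
          + (\<Sum>a\<in>F. \<Sum>b\<in>F. c a * cnj (c b) * (expfun a x * cnj (expfun b x))))"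
      proof
        fix x
        have 1: "(\<Sum>a\<in>F. cnj (c a) * (expfun t x * cnj (expfun a x))) = expfun t x * cnj (h x)"
          by (simp add: h_def sum_distrib_left mult_ac)
        have 2: "(\<Sum>a\<in>F. c a * (expfun a x * cnj (expfun t x))) = h x * cnj (expfun t x)"
          by (simp add: h_def sum_distrib_right mult.assoc)
        have 3: "(\<Sum>a\<in>F. \<Sum>b\<in>F. c a * cnj (c b) * (expfun a x * cnj (expfun b x))) = h x * cnj (h x)"
          by (simp add: h_def sum_product mult_ac)
        show "g x * cnj (g x) = expfun t x * cnj (expfun t x)
          - (\<Sum>a\<in>F. cnj (c a) * (expfun t x * cnj (expfun a x)))
          - (\<Sum>a\<in>F. c a * (expfun a x * cnj (expfun t x)))
          + (\<Sum>a\<in>F. \<Sum>b\<in>F. c a * cnj (c b) * (expfun a x * cnj (expfun b x)))"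
          unfolding 1 2 3 g_def by (simp add: algebra_simps)
      qed
      also have "(CLINT x|\<mu>. expfun t x * cnj (expfun t x)
          - (\<Sum>a\<in>F. cnj (c a) * (expfun t x * cnj (expfun a x)))
          - (\<Sum>a\<in>F. c a * (expfun a x * cnj (expfun t x)))
          + (\<Sum>a\<in>F. \<Sum>b\<in>F. c a * cnj (c b) * (expfun a x * cnj (expfun b x))))
        = (CLINT x|\<mu>. expfun t x * cnj (expfun t x))
          - (\<Sum>a\<in>F. cnj (c a) * c a) - (\<Sum>a\<in>F. c a * cnj (c a))
          + (\<Sum>a\<in>F. \<Sum>b\<in>F. c a * cnj (c b) * (CLINT x|\<mu>. expfun a x * cnj (expfun b x)))"
        using ei by (simp add: c c')
      also have "(\<Sum>a\<in>F. \<Sum>b\<in>F. c a * cnj (c b) * (CLINT x|\<mu>. expfun a x * cnj (expfun b x)))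
          = (\<Sum>a\<in>F. \<Sum>b\<in>F. if a = b then c a * cnj (c b) else 0)"
        using F(1) by (intro sum.cong refl) (auto simp: on subset_iff)
      also have "\<dots> = (\<Sum>a\<in>F. c a * cnj (c a))" using F(2) by simp
      also have "(CLINT x|\<mu>. expfun t x * cnj (expfun t x)) = 1"
        by (simp add: integral_expfun_mult_cnj char_zero)
      also have "1 - (\<Sum>a\<in>F. cnj (c a) * c a) - (\<Sum>a\<in>F. c a * cnj (c a)) + (\<Sum>a\<in>F. c a * cnj (c a))
         = complex_of_real (1 - (\<Sum>a\<in>F. (norm (c a))\<^sup>2))"
        unfolding of_real_diff of_real_sum complex_norm_square by (simp add: mult.commute)
      finally have "(\<integral>x. (norm (g x))\<^sup>2 \<partial>\<mu>) = 1 - (\<Sum>a\<in>F. (norm (c a))\<^sup>2)"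
        by (simp only: of_real_eq_iff)
      then have gs: "(\<integral>x. (norm (g x))\<^sup>2 \<partial>\<mu>) \<le> s\<^sup>2" using P by (simp add: c_def)
      have fg: "(\<lambda>x. f x * cnj (g x)) = (\<lambda>x. f x * cnj (expfun t x) - (\<Sum>a\<in>F. cnj (c a) * (f x * cnj (expfun a x))))"
        by (simp add: fun_eq_iff g_def h_def right_diff_distrib sum_distrib_left mult_ac)
      have "(CLINT x|\<mu>. f x * cnj (g x)) = (CLINT x|\<mu>. f x * cnj (expfun t x))
           - (\<Sum>a\<in>F. cnj (c a) * (CLINT x|\<mu>. f x * cnj (expfun a x)))"
        unfolding fg using fe by simp
      also have "(\<Sum>a\<in>F. cnj (c a) * (CLINT x|\<mu>. f x * cnj (expfun a x))) = 0"
        using F(1) f0 by (intro sum.neutral) auto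
      finally have "norm (CLINT x|\<mu>. f x * cnj (expfun t x)) = norm (CLINT x|\<mu>. f x * cnj (g x))" by simp
      \<comment> \<open>A weighted arithmetic-geometric mean inequality serves as Cauchy-Schwarz;
        with weight \<open>s\<close> both terms are of order \<open>s\<close> after
        integration.\<close>
      also have "\<dots> \<le> (\<integral>x. (s * (norm (f x))\<^sup>2 + (norm (g x))\<^sup>2 / s) / 2 \<partial>\<mu>)"
      proof (rule order_trans[OF integral_norm_bound integral_mono])
        have "integrable \<mu> (\<lambda>x. f x * cnj (g x))" unfolding fg using fe by simp
        then show "integrable \<mu> (\<lambda>x. norm (f x * cnj (g x)))" by (rule integrable_norm)
        show "integrable \<mu> (\<lambda>x. (s * (norm (f x))\<^sup>2 + (norm (g x))\<^sup>2 / s) / 2)" using f2 g2 by simp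
        fix x
        have "0 \<le> (s * norm (f x) - norm (g x))\<^sup>2 / s" using s by simp
        also have "\<dots> = s * (norm (f x))\<^sup>2 + (norm (g x))\<^sup>2 / s - 2 * (norm (f x) * norm (g x))"
          using s by (simp add: field_simps power2_eq_square)
        finally show "norm (f x * cnj (g x)) \<le> (s * (norm (f x))\<^sup>2 + (norm (g x))\<^sup>2 / s) / 2"
          by (simp add: norm_mult)
      qed
      also have "\<dots> = (s * A + (\<integral>x. (norm (g x))\<^sup>2 \<partial>\<mu>) / s) / 2"
        unfolding A_def using f2 g2 by simp
      also have "\<dots> \<le> (s * A + s\<^sup>2 / s) / 2"
        using gs s by (intro divide_right_mono add_left_mono) auto
      also have "\<dots> = s * (A + 1) / 2" using s by (simp add: power2_eq_square algebra_simps)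
      finally show ?thesis .
    qed
    have "A \<ge> 0" unfolding A_def by simp
    have zero: "(CLINT x|\<mu>. f x * cnj (expfun t x)) = 0" for t
    proof (rule ccontr)
      assume "\<not> ?thesis"
      then have pos: "norm (CLINT x|\<mu>. f x * cnj (expfun t x)) > 0" (is "?n > 0") by simp
      \<comment> \<open>This choice of \<open>s\<close> turns the bound into
        \<open>?n <= ?n / 2\<close>.\<close>
      from le[of "?n / (A + 1)" t] pos \<open>A \<ge> 0\<close> show False by simp
    qed
    fix t :: real
    have "cnj (expfun (t / (2 * pi)) x) = iexp (t * x)" for x
      by (simp add: expfun_def cis_cnj) (simp add: cis_conv_exp)
    then show "(CLINT x|\<mu>. f x * iexp (t * x)) = 0" using zero[of "t / (2 * pi)"] by simp
  qed
  then show ?thesis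
    unfolding spectral_measure_def using on count by (intro exI[of _ \<Lambda>] conjI ballI allI impI) auto
qed

section \<open>Parseval's identity and spectrality for the limit measure\<close>

context digit_system
begin

text \<open>The sums \<open>S\<close> increase and are at most 1, so beyond some \<open>i\<close>
  their increments are small. At a late consecutive level \<open>n\<close> the squares of
  \<open>phi n\<close> sum to 1 over \<open>spectrum n\<close>, and the part outside
  \<open>spectrum i\<close> is at most \<open>64\<^sup>2\<close> times an increment of
  \<open>S\<close>. Over the fixed finite set \<open>spectrum i\<close> the level may then tend to
  infinity, which yields \<open>S i\<close>.\<close>

lemma Parseval_limit:
  fixes nk :: "nat \<Rightarrow> nat"
  assumes lim: "\<And>t. (\<lambda>n. phi n t) \<longlonglongrightarrow> h t"
    and nk: "strict_mono nk" "\<And>k. general_consecutive (N (nk k)) (B (nk k))" and "\<eta> > 0"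
  shows "\<exists>n. 1 - \<eta> \<le> (\<Sum>a\<in>spectrum n. (norm (h (t + of_int a)))\<^sup>2)"
proof -
  define S where "S n = (\<Sum>a\<in>spectrum n. (norm (h (t + of_int a)))\<^sup>2)" for n
  have lim2: "(\<lambda>n. \<Sum>a\<in>F. (norm (phi n (t + of_int a)))\<^sup>2) \<longlonglongrightarrow> (\<Sum>a\<in>F. (norm (h (t + of_int a)))\<^sup>2)" for F
    by (intro tendsto_sum tendsto_power tendsto_norm lim)
  have S_le: "S n \<le> 1" for n
    unfolding S_def
  proof (rule tendsto_upperbound[OF lim2])
    show "\<forall>\<^sub>F i in sequentially. (\<Sum>a\<in>spectrum n. (norm (phi i (t + of_int a)))\<^sup>2) \<le> 1"
      using eventually_ge_at_top[of n]
    proof eventually_elim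
      case (elim i)
      have "(\<Sum>a\<in>spectrum n. (norm (phi i (t + of_int a)))\<^sup>2) \<le> (\<Sum>a\<in>spectrum i. (norm (phi i (t + of_int a)))\<^sup>2)"
        using spectrum_mono[OF elim] finite_spectrum by (intro sum_mono2) auto
      then show ?case by (simp add: sum_phi_spectrum)
    qed
  qed simp
  have "incseq S"
    unfolding S_def by (intro incseq_SucI sum_mono2 finite_spectrum spectrum_subset_Suc) auto
  then have "convergent S" using S_le by (intro Bseq_monoseq_convergent BseqI'[of _ 1])
      (auto simp: monoseq_iff S_def sum_nonneg)
  then have "Cauchy S" by (rule convergent_Cauchy)
  \<comment> \<open>\<open>8192 = 2 * 64\<^sup>2\<close>, so the part outside
    \<open>spectrum i\<close> will be at most \<open>\<eta> / 2\<close>.\<close>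
  moreover have "\<eta> / 8192 > 0" using \<open>\<eta> > 0\<close> by simp
  ultimately obtain i where i: "\<And>m n. m \<ge> i \<Longrightarrow> n \<ge> i \<Longrightarrow> dist (S m) (S n) < \<eta> / 8192"
    unfolding Cauchy_def by blast
  have nk_top: "filterlim nk at_top sequentially" by (rule filterlim_subseq[OF nk(1)])
  \<comment> \<open>\<open>|t| <= Q n / 6\<close> together with \<open>|a| <= Q n / 2\<close> gives
    exactly the range \<open>2/3 * Q n\<close> of \<open>norm_phi_ge_consecutive\<close>.\<close>
  have "\<forall>\<^sub>F n in sequentially. (bad_ratio n \<le> 1 / 16 \<and> (\<forall>d. (\<Sum>j=Suc n..<Suc n+d. bad_ratio j) \<le> 1 / 16)) \<and>
     n \<ge> i \<and> real_of_int (Q n) \<ge> 6 * \<bar>t\<bar>"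
    using eventually_tail_small eventually_ge_at_top[of i]
      Q_at_top[unfolded filterlim_at_top, rule_format, of "6 * \<bar>t\<bar>"]
    by eventually_elim auto
  then have ev: "\<forall>\<^sub>F k in sequentially. (bad_ratio (nk k) \<le> 1 / 16 \<and> (\<forall>d. (\<Sum>j=Suc (nk k)..<Suc (nk k)+d. bad_ratio j) \<le> 1 / 16)) \<and>
     nk k \<ge> i \<and> real_of_int (Q (nk k)) \<ge> 6 * \<bar>t\<bar>"
    using nk_top by (rule eventually_compose_filterlim)
  have "1 - \<eta> / 2 \<le> S i"
    unfolding S_def
  proof (rule tendsto_lowerbound)
    show "((\<lambda>k. \<Sum>a\<in>spectrum i. (norm (phi (nk k) (t + of_int a)))\<^sup>2) \<longlongrightarrow> (\<Sum>a\<in>spectrum i. (norm (h (t + of_int a)))\<^sup>2)) sequentially"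
      using filterlim_compose[OF lim2 nk_top] .
    show "\<forall>\<^sub>F k in sequentially. 1 - \<eta> / 2 \<le> (\<Sum>a\<in>spectrum i. (norm (phi (nk k) (t + of_int a)))\<^sup>2)"
      using ev
    proof eventually_elim
      case (elim k)
      define n where "n = nk k"
      have bound: "norm (phi n (t + of_int a)) \<le> 64 * norm (h (t + of_int a))" if "a \<in> spectrum n" for a
      proof (rule tendsto_lowerbound)
        show "((\<lambda>k. 64 * norm (phi k (t + of_int a))) \<longlongrightarrow> 64 * norm (h (t + of_int a))) sequentially"
          by (intro tendsto_intros lim)
        have "\<bar>2 * a\<bar> \<le> Q n" using spectrum_bounds[OF that] by linarith
        then have "\<bar>2 * real_of_int a\<bar> \<le> of_int (Q n)" by linarith
        then have "\<bar>t + of_int a\<bar> \<le> 2 / 3 * of_int (Q n)" using elim unfolding n_def by linarith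
        then have "norm (phi n (t + of_int a)) \<le> 64 * norm (phi j (t + of_int a))" if "n < j" for j
          using elim nk(2)[of k] that unfolding n_def by (intro norm_phi_ge_consecutive) blast+
        then show "\<forall>\<^sub>F j in sequentially. norm (phi n (t + of_int a)) \<le> 64 * norm (phi j (t + of_int a))"
          using eventually_gt_at_top[of n] by (rule eventually_mono[rotated])
      qed simp
      have sub: "spectrum i \<subseteq> spectrum n" using elim by (intro spectrum_mono) (simp add: n_def)
      have split: "(\<Sum>a\<in>spectrum n. f a) = (\<Sum>a\<in>spectrum i. f a) + (\<Sum>a\<in>spectrum n - spectrum i. f a)" for f :: "int \<Rightarrow> real"
        using sub finite_spectrum by (subst add.commute, intro sum.subset_diff) auto
      have "(\<Sum>a\<in>spectrum n - spectrum i. (norm (phi n (t + of_int a)))\<^sup>2)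
          \<le> (\<Sum>a\<in>spectrum n - spectrum i. 4096 * (norm (h (t + of_int a)))\<^sup>2)"
      proof (rule sum_mono)
        fix a assume "a \<in> spectrum n - spectrum i"
        then have "(norm (phi n (t + of_int a)))\<^sup>2 \<le> (64 * norm (h (t + of_int a)))\<^sup>2"
          using bound by (intro power_mono) auto
        then show "(norm (phi n (t + of_int a)))\<^sup>2 \<le> 4096 * (norm (h (t + of_int a)))\<^sup>2"
          by (simp add: power_mult_distrib)
      qed
      also have "\<dots> = 4096 * (S n - S i)"
        by (simp add: S_def split[of "\<lambda>a. (norm (h (t + of_int a)))\<^sup>2"] sum_distrib_left)
      also have "\<dots> \<le> \<eta> / 2"
      proof -
        have "\<bar>S n - S i\<bar> < \<eta> / 8192" using i[of n i] elim by (simp add: n_def dist_real_def)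
        then have "S n - S i \<le> \<eta> / 8192" by (rule order_trans[OF abs_ge_self less_imp_le])
        then show ?thesis by simp
      qed
      finally show ?case
        using sum_phi_spectrum[of n t] split[of "\<lambda>a. (norm (phi n (t + of_int a)))\<^sup>2"] by (simp add: n_def)
    qed
  qed simp
  then show ?thesis using \<open>\<eta> > 0\<close> unfolding S_def by (intro exI[of _ i]) simp
qed

lemma spectral_measure_limit:
  fixes nk :: "nat \<Rightarrow> nat"
  assumes rd: "real_distribution \<mu>"
    and lim: "\<And>t. (\<lambda>n. phi n t) \<longlonglongrightarrow> char \<mu> (- 2 * pi * t)"
    and nk: "strict_mono nk" "\<And>k. general_consecutive (N (nk k)) (B (nk k))"
  shows "spectral_measure \<mu>"
proof (rule spectral_measureI_Parseval[OF rd])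
  let ?\<Lambda> = "real_of_int ` (\<Union>n. spectrum n)"
  show "countable ?\<Lambda>" by simp
  fix a b assume "a \<in> ?\<Lambda>" "b \<in> ?\<Lambda>" and "a \<noteq> b"
  then obtain a' b' m n where ab: "a = of_int a'" "b = of_int b'" "a' \<in> spectrum m" "b' \<in> spectrum n" "a' \<noteq> b'" by auto
  show "char \<mu> (- 2 * pi * (a - b)) = 0"
  proof (rule LIMSEQ_unique[OF lim])
    \<comment> \<open>From level \<open>max m n\<close> on both elements lie in the same spectrum,
      so the transform vanishes at their difference already before the limit.\<close>
    have "\<forall>\<^sub>F k in sequentially. phi k (a - b) = 0"
      using eventually_ge_at_top[of "max m n"]
    proof eventually_elim
      case (elim k)
      then have "a' \<in> spectrum k" "b' \<in> spectrum k" using ab spectrum_mono[of m k] spectrum_mono[of n k] by auto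
      then show ?case using phi_spectrum_orthogonal[of a' k b'] ab by simp
    qed
    then show "(\<lambda>k. phi k (a - b)) \<longlonglongrightarrow> 0" by (rule tendsto_eventually)
  qed
next
  let ?\<Lambda> = "real_of_int ` (\<Union>n. spectrum n)"
  interpret real_distribution \<mu> by (rule rd)
  fix t \<eta> :: real assume "\<eta> > 0"
  \<comment> \<open>\<open>Parseval_limit\<close> translates by \<open>+ a\<close>, the criterion by
    \<open>- a\<close>. Evaluation at \<open>- t\<close> and evenness of the modulus of
    \<open>char\<close> reconcile the two.\<close>
  from Parseval_limit[OF lim nk this, of "- t"] obtain n where
    n: "1 - \<eta> \<le> (\<Sum>a\<in>spectrum n. (norm (char \<mu> (- 2 * pi * (- t + of_int a))))\<^sup>2)" by auto
  have "norm (char \<mu> (- s)) = norm (char \<mu> s)" for s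
  proof -
    have "char \<mu> (- s) = cnj (char \<mu> s)"
      unfolding char_def Bochner_Integration.integral_cnj[symmetric]
      by (intro Bochner_Integration.integral_cong) (auto simp: exp_cnj)
    then show ?thesis by simp
  qed
  then have "norm (char \<mu> (- 2 * pi * (- t + u))) = norm (char \<mu> (- 2 * pi * (t - u)))" for u
    by (metis add_uminus_conv_diff minus_add minus_minus mult_minus_right add.commute)
  with n have "1 - \<eta> \<le> (\<Sum>a\<in>real_of_int ` spectrum n. (norm (char \<mu> (- 2 * pi * (t - a))))\<^sup>2)"
    by (subst sum.reindex) (simp_all add: inj_on_def o_def)
  then show "\<exists>F\<subseteq>?\<Lambda>. finite F \<and> 1 - \<eta> \<le> (\<Sum>a\<in>F. (norm (char \<mu> (- 2 * pi * (t - a))))\<^sup>2)"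
    using finite_spectrum by (intro exI[of _ "real_of_int ` spectrum n"]) auto
qed

end

theorem theorem2p2:
  fixes N :: "nat \<Rightarrow> int" and B :: "nat \<Rightarrow> int set"
  assumes adm: "\<And>n. admissible_pair (N n) (B n)"
    and pos: "\<And>n. N n > 0"
    and rbc: "summable (\<lambda>n. real (card (B n - B n \<inter> {0..N n - 1})) / real (card (B n)))"
    and sub: "\<exists>nk :: nat \<Rightarrow> nat. strict_mono nk \<and>
                (\<forall>k. general_consecutive (N (nk k)) (B (nk k)))"
  shows "\<exists>\<mu>. real_distribution \<mu> \<and> weak_converges (conv_partial N B) \<mu> \<and> spectral_measure \<mu>"
proof -
  have "\<exists>L. finite L \<and> 0 \<in> L \<and> (\<forall>x. (\<Sum>l\<in>L. (norm (mask_fun (B n) (x + of_int l / of_int (N n))))\<^sup>2) = 1)" for n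
    using admissible_pair_spectrum[OF adm[of n]] by metis
  then obtain L where L: "\<And>n. finite (L n)" "\<And>n. 0 \<in> L n"
    "\<And>n x. (\<Sum>l\<in>L n. (norm (mask_fun (B n) (x + of_int l / of_int (N n))))\<^sup>2) = 1"
    by metis
  \<comment> \<open>Positivity sharpens \<open>|N n| > 1\<close> to \<open>N n >= 2\<close>.\<close>
  interpret digit_system N B L
  proof
    show "2 \<le> N n" "finite (B n)" "B n \<noteq> {}" for n
      using adm[of n] pos[of n] by (auto simp: admissible_pair_def)
  qed (use L rbc in auto)
  obtain \<mu> where "real_distribution \<mu>" "weak_converges (conv_partial N B) \<mu>"
    "\<And>t. (\<lambda>n. phi n t) \<longlonglongrightarrow> char \<mu> (- 2 * pi * t)"
    using conv_partial_weak_limit by blast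
  with sub show ?thesis using spectral_measure_limit by metis
qed

end
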